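(* There exist absolute constants $c,c'>0$ such that the following holds. (i) For every product probability measure $\mu$ on $\{0,1\}^{\mathbb N}$ whose mean $p=\mathbb E_{X\sim\mu}[X]$ belongs to $\mathsf{LGC}$, $$c\sqrt{S(p)}\le\liminf_{n\to\infty}\sqrt n\,\Delta_n(p)\le\limsup_{n\to\infty}\sqrt n\,\Delta_n(p)\le c'\sqrt{S(p)}.$$ (ii) For every (not necessarily product) probability measure $\mu$ on $\{0,1\}^{\mathbb N}$ with $T(\mu)<\infty$, $$\limsup_{n\to\infty}\sqrt n\,\Delta_n(\mu)\le c'\sqrt{S(\mu)}.$$
   Context: $\mathbb N=\{1,2,3,\dots\}$; $\log$ is the natural logarithm. $\{0,1\}^{\mathbb N}$ carries the $\sigma$-algebra generated by finite-dimensional cylinders. For a probability measure $\mu$ on $\{0,1\}^{\mathbb N}$, let $p=\mathbb E_{X\sim\mu}[X]\in[0,1]^{\mathbb N}$ be its mean, i.e. $p(j)=\mathbb E[X(j)]$. Given $n$ i.i.d. draws $X_1,\dots,X_n\sim\mu$, let $\hat p_n(j)=\frac1n\sum_{i=1}^nX_i(j)$ and $\Delta_n(\mu)=\mathbb E\sup_{j\in\mathbb N}|\hat p_n(j)-p(j)|$. For $p\in[0,1]^{\mathbb N}$, $\Delta_n(p)$ denotes $\Delta_n(\mu)$ for the product measure $\mu=\bigotimes_{j}\mathrm{Bernoulli}(p(j))$ (coordinates independent). $[0,\frac12]^{\mathbb N}_{\downarrow0}$ is the set of all non-increasing sequences $p:\mathbb N\to[0,\frac12]$ with $p(j)\to0$,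 and $\mathsf{LGC}=\{p\in[0,\frac12]^{\mathbb N}_{\downarrow0}:\Delta_n(p)\to0\text{ as }n\to\infty\}$. For $p\in[0,\frac12]^{\mathbb N}_{\downarrow0}$, $$S(p)=\sup_{j\in\mathbb N}p(j)\log(j+1),\qquad T(p)=\sup_{j\in\mathbb N}\frac{\log(j+1)}{\log(1/p(j))},$$ where a term of $T$ with $p(j)=0$ is interpreted as $0$. For a general $\mu$ with mean $p$, put $\tilde p(j)=\min\{p(j),1-p(j)\}$. If $\tilde p(j)\to0$, let $\tilde p^{\downarrow}$ be its non-increasing rearrangement ($\tilde p^{\downarrow}(j)$ is the $j$-th largest entry of $\tilde p$, counted with multiplicity) and set $S(\mu)=S(\tilde p^{\downarrow})$, $T(\mu)=T(\tilde p^{\downarrow})$; otherwise set $S(\mu)=T(\mu)=\infty$. *)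

theory Defs
  imports "HOL-Probability.Probability"
begin

text \<open>
  Coordinates are indexed from 0: the entry \<open>p j\<close> stands for the mathematical \<open>p(j + 1)\<close>. Hence the
  weight \<open>log (j + 1)\<close> of the 1-based coordinate \<open>j\<close> reads \<open>ln (real j + 2)\<close>. Points of
  \<open>{0,1}^N\<close> are Boolean sequences, with values read as numbers through \<^const>\<open>of_bool\<close>.
\<close>

definition cube :: "(nat \<Rightarrow> bool) measure"
  where "cube = (\<Pi>\<^sub>M j\<in>UNIV. count_space UNIV)"

definition prob_on_cube :: "(nat \<Rightarrow> bool) measure \<Rightarrow> bool"
  where "prob_on_cube M \<longleftrightarrow> prob_space M \<and> sets M = sets cube"

definition product_prob_on_cube :: "(nat \<Rightarrow> bool) measure \<Rightarrow> bool"
  where "product_prob_on_cube M \<longleftrightarrow>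
    (\<exists>\<nu> :: nat \<Rightarrow> bool measure.
       (\<forall>j. prob_space (\<nu> j) \<and> sets (\<nu> j) = sets (count_space UNIV)) \<and>
       M = (\<Pi>\<^sub>M j\<in>UNIV. \<nu> j))"

definition mean :: "(nat \<Rightarrow> bool) measure \<Rightarrow> nat \<Rightarrow> real"
  where "mean M j = (\<integral>x. of_bool (x j) \<partial>M)"

text \<open>The \<open>n\<close> i.i.d. draws are the coordinates \<open>X 0, \<dots>, X (n - 1)\<close> of the \<open>n\<close>-fold power of \<open>M\<close>.\<close>

definition emp_mean :: "nat \<Rightarrow> (nat \<Rightarrow> nat \<Rightarrow> bool) \<Rightarrow> nat \<Rightarrow> real"
  where "emp_mean n X j = (\<Sum>i<n. of_bool (X i j)) / real n"

definition Delta :: "nat \<Rightarrow> (nat \<Rightarrow> bool) measure \<Rightarrow> real"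
  where "Delta n M =
    (\<integral>X. (SUP j. \<bar>emp_mean n X j - mean M j\<bar>) \<partial>(\<Pi>\<^sub>M i\<in>{..<n}. M))"

definition bernoulli_product :: "(nat \<Rightarrow> real) \<Rightarrow> (nat \<Rightarrow> bool) measure"
  where "bernoulli_product p = (\<Pi>\<^sub>M j\<in>UNIV. measure_pmf (bernoulli_pmf (p j)))"

definition Delta_seq :: "nat \<Rightarrow> (nat \<Rightarrow> real) \<Rightarrow> real"
  where "Delta_seq n p = Delta n (bernoulli_product p)"

definition decreasing_null_seqs :: "(nat \<Rightarrow> real) set"
  where "decreasing_null_seqs = {p. (\<forall>j. p j \<in> {0..1/2}) \<and> antimono p \<and> p \<longlonglongrightarrow> 0}"

definition LGC :: "(nat \<Rightarrow> real) set"
  where "LGC = {p \<in> decreasing_null_seqs. (\<lambda>n. Delta_seq n p) \<longlonglongrightarrow> 0}"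

definition S_seq :: "(nat \<Rightarrow> real) \<Rightarrow> ereal"
  where "S_seq p = (SUP j. ereal (p j * ln (real j + 2)))"

definition T_seq :: "(nat \<Rightarrow> real) \<Rightarrow> ereal"
  where "T_seq p = (SUP j. ereal (if p j = 0 then 0 else ln (real j + 2) / ln (1 / p j)))"

definition fold_half :: "(nat \<Rightarrow> real) \<Rightarrow> nat \<Rightarrow> real"
  where "fold_half p j = min (p j) (1 - p j)"

text \<open>
  For \<open>q \<ge> 0\<close> with \<open>q \<longlonglongrightarrow> 0\<close>, the (0-based) \<open>j\<close>-th largest entry with multiplicity: the largest
  value attained as the minimum of \<open>q\<close> over \<open>j + 1\<close> distinct indices. See
  \<open>rearrangement_ge_iff\<close> and \<open>rearrangement_enumerates\<close> below.
\<close>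

definition rearrangement :: "(nat \<Rightarrow> real) \<Rightarrow> nat \<Rightarrow> real"
  where "rearrangement q j = (SUP A\<in>{A. card A = Suc j}. Min (q ` A))"

definition S_meas :: "(nat \<Rightarrow> bool) measure \<Rightarrow> ereal"
  where "S_meas M =
    (if fold_half (mean M) \<longlonglongrightarrow> 0 then S_seq (rearrangement (fold_half (mean M))) else \<infinity>)"

definition T_meas :: "(nat \<Rightarrow> bool) measure \<Rightarrow> ereal"
  where "T_meas M =
    (if fold_half (mean M) \<longlonglongrightarrow> 0 then T_seq (rearrangement (fold_half (mean M))) else \<infinity>)"

text \<open>The square root on \<open>[0, \<infinity>]\<close>.\<close>

definition esqrt :: "ereal \<Rightarrow> ereal"
  where "esqrt x = (if x = \<infinity> then \<infinity> else ereal (sqrt (real_of_ereal x)))"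

lemma null_seq_level_finite:
  fixes q :: "nat \<Rightarrow> real"
  assumes "q \<longlonglongrightarrow> 0" "t > 0"
  shows "finite {i. q i \<ge> t}"
proof -
  have "\<forall>\<^sub>F i in sequentially. q i < t"
    using order_tendstoD(2)[OF assms] .
  then obtain N where "\<And>i. i \<ge> N \<Longrightarrow> q i < t"
    by (auto simp: eventually_sequentially)
  then have "{i. q i \<ge> t} \<subseteq> {..<N}"
    by (force simp: not_le[symmetric])
  then show ?thesis
    using finite_subset by blast
qed

lemma Min_image_ge_iff:
  fixes q :: "nat \<Rightarrow> real"
  assumes "card A = Suc j"
  shows "Min (q ` A) \<ge> t \<longleftrightarrow> (\<forall>i\<in>A. q i \<ge> t)"
proof -
  have "finite A" "A \<noteq> {}"
    using assms by (auto intro: card_ge_0_finite)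
  then show ?thesis
    by simp
qed

lemma bdd_above_Min_images:
  fixes q :: "nat \<Rightarrow> real"
  assumes "q \<longlonglongrightarrow> 0"
  shows "bdd_above ((\<lambda>A. Min (q ` A)) ` {A. card A = Suc j})"
proof -
  obtain B where B: "\<And>i. \<bar>q i\<bar> \<le> B"
    using convergent_imp_Bseq[of q] assms by (auto simp: convergent_def Bseq_def)
  have "Min (q ` A) \<le> B" if "card A = Suc j" for A
  proof -
    have "finite A" "A \<noteq> {}"
      using that by (auto intro: card_ge_0_finite)
    then obtain i where "i \<in> A" by blast
    then have "Min (q ` A) \<le> q i"
      using \<open>finite A\<close> by simp
    also have "\<dots> \<le> B"
      using B[of i] by simp
    finally show ?thesis .
  qed
  then show ?thesis
    by (auto intro!: bdd_aboveI[of _ B])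
qed

lemma rearrangement_ge_iff:
  fixes q :: "nat \<Rightarrow> real"
  assumes lim: "q \<longlonglongrightarrow> 0" and t: "t > 0"
  shows "rearrangement q j \<ge> t \<longleftrightarrow> j < card {i. q i \<ge> t}"
proof -
  let ?C = "{A :: nat set. card A = Suc j}"
  have ne: "?C \<noteq> {}"
    using card_lessThan[of "Suc j"] by blast
  note bdd = bdd_above_Min_images[OF lim, of j]
  show ?thesis
  proof
    assume "j < card {i. q i \<ge> t}"
    then obtain A where A: "A \<subseteq> {i. q i \<ge> t}" "card A = Suc j"
      by (meson Suc_leI obtain_subset_with_card_n)
    then have "t \<le> Min (q ` A)"
      by (subst Min_image_ge_iff) auto
    also have "\<dots> \<le> rearrangement q j"
      unfolding rearrangement_def using A bdd by (intro cSUP_upper) auto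
    finally show "rearrangement q j \<ge> t" .
  next
    assume ge: "rearrangement q j \<ge> t"
    show "j < card {i. q i \<ge> t}"
    proof (rule ccontr)
      assume neg: "\<not> j < card {i. q i \<ge> t}"
      define F where "F = {i. q i \<ge> t / 2} - {i. q i \<ge> t}"
      have finF: "finite F"
        unfolding F_def using null_seq_level_finite[OF lim, of "t / 2"] t by auto
      define s where "s = Max (insert (t / 2) (q ` F))"
      have "s < t"
        unfolding s_def using finF t by (auto simp: F_def)
      have s: "q i \<le> s" if "q i < t" for i
      proof (cases "q i \<ge> t / 2")
        case True
        with that finF show ?thesis
          unfolding s_def by (intro Max_ge) (auto simp: F_def)
      next
        case False
        moreover have "t / 2 \<le> s"
          unfolding s_def using finF by (intro Max_ge) auto
        ultimately show ?thesis by simp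
      qed
      have "Min (q ` A) \<le> s" if A: "card A = Suc j" for A
      proof -
        have finA: "finite A"
          using A by (auto intro: card_ge_0_finite)
        have "\<not> A \<subseteq> {i. q i \<ge> t}"
          using card_mono[OF null_seq_level_finite[OF lim t], of A] A neg by auto
        then obtain i where "i \<in> A" "q i < t"
          by (auto simp: subset_iff not_le)
        then show ?thesis
          using s finA by (meson Min_le finite_imageI imageI order_trans)
      qed
      then have "rearrangement q j \<le> s"
        unfolding rearrangement_def using ne by (intro cSUP_least) auto
      with ge \<open>s < t\<close> show False by simp
    qed
  qed
qed

lemma rearrangement_nonneg:
  fixes q :: "nat \<Rightarrow> real"
  assumes "q \<longlonglongrightarrow> 0" "\<And>i. q i \<ge> 0"
  shows "rearrangement q j \<ge> 0"
proof -
  have "0 \<le> Min (q ` {..j})"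
    using assms(2) by simp
  also have "\<dots> \<le> rearrangement q j"
    unfolding rearrangement_def
    by (intro cSUP_upper bdd_above_Min_images assms) simp
  finally show ?thesis .
qed

text \<open>Every positive value occurs in \<open>rearrangement q\<close> exactly as often as in \<open>q\<close>.\<close>

lemma rearrangement_enumerates:
  fixes q :: "nat \<Rightarrow> real"
  assumes lim: "q \<longlonglongrightarrow> 0" and "\<And>i. q i \<ge> 0"
  shows "antimono (rearrangement q)"
    and "t > 0 \<Longrightarrow> card {j. rearrangement q j = t} = card {i. q i = t}"
proof -
  show "antimono (rearrangement q)"
  proof (rule antimonoI)
    fix a b :: nat
    assume "a \<le> b"
    show "rearrangement q b \<le> rearrangement q a"
    proof (cases "rearrangement q b > 0")
      case True
      then show ?thesis
        using rearrangement_ge_iff[OF lim True, of b] rearrangement_ge_iff[OF lim True, of a]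
          \<open>a \<le> b\<close> by simp
    next
      case False
      then show ?thesis
        using rearrangement_nonneg[OF assms, of a] by linarith
    qed
  qed
  assume t: "t > 0"
  have level: "{j. rearrangement q j \<ge> s} = {..<card {i. q i \<ge> s}}" if "s > 0" for s
    using rearrangement_ge_iff[OF lim that] by auto
  let ?r = "rearrangement q"
  define V where "V = {v \<in> q ` {i. q i \<ge> t} \<union> ?r ` {j. ?r j \<ge> t}. v > t}"
  have finr: "finite {j. ?r j \<ge> t}" and finq: "finite {i. q i \<ge> t}"
    using level[OF t] null_seq_level_finite[OF lim t] by auto
  have finV: "finite V"
    unfolding V_def using finr finq by simp
  define s where "s = Min (insert (t + 1) V)"
  have s: "s > t"
    unfolding s_def using finV by (auto simp: V_def)
  have gap: "v \<ge> s" if "v \<in> V" for v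
    unfolding s_def using that finV by simp
  have q_eq: "{i. q i = t} = {i. q i \<ge> t} - {i. q i \<ge> s}"
  proof (intro equalityI subsetI)
    fix i assume "i \<in> {i. q i \<ge> t} - {i. q i \<ge> s}"
    then show "i \<in> {i. q i = t}"
      using gap[of "q i"] by (cases "q i = t") (auto simp: V_def)
  qed (use s in auto)
  have r_eq: "{j. ?r j = t} = {j. ?r j \<ge> t} - {j. ?r j \<ge> s}"
  proof (intro equalityI subsetI)
    fix i assume "i \<in> {i. ?r i \<ge> t} - {i. ?r i \<ge> s}"
    then show "i \<in> {i. ?r i = t}"
      using gap[of "?r i"] by (cases "?r i = t") (auto simp: V_def)
  qed (use s in auto)
  have "card {j. ?r j = t} = card {j. ?r j \<ge> t} - card {j. ?r j \<ge> s}"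
    unfolding r_eq
  proof (rule card_Diff_subset)
    show sub: "{j. ?r j \<ge> s} \<subseteq> {j. ?r j \<ge> t}"
      using s by auto
    show "finite {j. ?r j \<ge> s}"
      by (rule finite_subset[OF sub finr])
  qed
  also have "\<dots> = card {i. q i \<ge> t} - card {i. q i \<ge> s}"
    using level[OF t] level[of s] s t by simp
  also have "\<dots> = card {i. q i = t}"
    unfolding q_eq
  proof (rule card_Diff_subset[symmetric])
    show sub: "{i. q i \<ge> s} \<subseteq> {i. q i \<ge> t}"
      using s by auto
    show "finite {i. q i \<ge> s}"
      by (rule finite_subset[OF sub finq])
  qed
  finally show "card {j. ?r j = t} = card {i. q i = t}" .
qed

end

theory Submission
  imports Defs "HOL-Real_Asymp.Real_Asymp"
begin

text \<open>
  Upper bound: for every level \<open>s > 0\<close>, the expected supremum is at most \<open>s\<close> plus the sum over the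
  coordinates of \<open>E (\<bar>Y j\<bar> - s)\<^sub>+\<close>, where \<open>Y j\<close> is the deviation of coordinate \<open>j\<close>, and each summand is
  bounded through the moment generating function of \<open>Y j\<close> at a point \<open>n \<theta>\<close> chosen separately for
  each coordinate. Let \<open>q\<close> be the folded mean of the coordinate and \<open>r\<close> its rank, so that
  \<open>q ln (r + 2) \<le> S\<close> and \<open>ln (r + 2) \<le> T ln (1 / q)\<close>. With \<open>s = 3 sqrt (S / n)\<close>, coordinates with
  \<open>q \<ge> s / 2\<close> are in the Gaussian regime and contribute \<open>O(sqrt (S / n) / (r + 2)\<^sup>2)\<close>; the others are
  in the Poisson regime, where finiteness of \<open>T\<close> makes the contribution \<open>O(1 / (n (r + 2)\<^sup>2))\<close>.

  Lower bound: for fixed \<open>j\<close>, the first \<open>j + 1\<close> normalized deviations converge to independent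
  Gaussians of variance at least \<open>p j / 2\<close>, and one of these exceeds
  \<open>sqrt (ln (j + 2))\<close> standard deviations with probability bounded below.

  Membership in \<open>LGC\<close> forces \<open>T < \<infinity>\<close>: if \<open>(j + 1) p(j)\<^sup>n \<ge> 1\<close>, then with probability at least
  \<open>1 - 1 / e\<close> all \<open>n\<close> draws are one in some coordinate \<open>i \<le> j\<close>, although \<open>p i \<le> 1 / 2\<close>.
\<close>

subsection \<open>Moment generating functions\<close>

text \<open>The left side is the moment generating function at \<theta> of a centered Bernoulli
  variable. The bound \<open>1 + x \<le> exp x\<close> gives the exponent
  \<open>p * (exp \<theta> - 1 - \<theta>)\<close>, and \<open>x \<le> sinh x\<close> for
  \<open>x \<ge> 0\<close> allows \<theta> to be replaced by its absolute value. For
  \<open>p > 1 / 2\<close>, exchanging success and failure, that is \<open>(p, \<theta>)\<close> for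
  \<open>(1 - p, - \<theta>)\<close>, produces the minimum.\<close>

lemma centered_exp_le:
  fixes p \<theta> :: real
  assumes "0 \<le> p" "p \<le> 1"
  shows "exp (- (\<theta> * p)) * (1 + p * (exp \<theta> - 1))
    \<le> exp (min p (1 - p) * (exp \<bar>\<theta>\<bar> - 1 - \<bar>\<theta>\<bar>))"
proof -
  have *: "exp (- (t * q)) * (1 + q * (exp t - 1)) \<le> exp (q * (exp \<bar>t\<bar> - 1 - \<bar>t\<bar>))"
    if "0 \<le> q" for q t :: real
  proof -
    have "exp (- (t * q)) * (1 + q * (exp t - 1)) \<le> exp (- (t * q)) * exp (q * (exp t - 1))"
      by (intro mult_left_mono exp_ge_add_one_self) auto
    also have "\<dots> = exp (q * (exp t - 1 - t))"
      by (simp add: exp_add[symmetric] algebra_simps)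
    also have "exp t - 1 - t \<le> exp \<bar>t\<bar> - 1 - \<bar>t\<bar>"
    proof (cases "t \<ge> 0")
      case False
      then show ?thesis
        using real_le_x_sinh[of "- t"] by (simp add: exp_minus)
    qed auto
    then have "exp (q * (exp t - 1 - t)) \<le> exp (q * (exp \<bar>t\<bar> - 1 - \<bar>t\<bar>))"
      using that by (simp add: mult_left_mono)
    finally show ?thesis .
  qed
  show ?thesis
  proof (cases "p \<le> 1 / 2")
    case True
    then show ?thesis
      using *[of p \<theta>] assms by (simp add: min_def)
  next
    case False
    have "exp (- (\<theta> * p)) * (1 + p * (exp \<theta> - 1))
      = exp (- (- \<theta> * (1 - p))) * (1 + (1 - p) * (exp (- \<theta>) - 1))"
      by (simp add: algebra_simps exp_diff exp_minus divide_simps)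
    then show ?thesis
      using *[of "1 - p" "- \<theta>"] assms False by (simp add: min_def)
  qed
qed

locale cube_measure = prob_space M for M :: "(nat \<Rightarrow> bool) measure" +
  assumes sets_M[measurable_cong]: "sets M = sets cube"
begin

lemma measurable_coord[measurable]: "(\<lambda>x. x j) \<in> measurable M (count_space UNIV)"
  by (subst measurable_cong_sets[OF sets_M refl]) (simp add: cube_def)

sublocale product_sigma_finite "\<lambda>_ :: nat. M"
  by unfold_locales

lemma mean_bounds: "0 \<le> mean M j" "mean M j \<le> 1"
  unfolding mean_def by (auto intro!: integral_nonneg integral_le_const integrable_const_bound[of _ 1])

lemma fold_half_mean_bounds: "0 \<le> fold_half (mean M) j" "fold_half (mean M) j \<le> 1/2"
  using mean_bounds[of j] unfolding fold_half_def by linarith+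

lemma prob_space_power: "prob_space (\<Pi>\<^sub>M i\<in>{..<n}. M)"
  by (intro prob_space_PiM) (rule prob_space_axioms)

lemma measurable_emp_mean[measurable]:
  "(\<lambda>X. emp_mean n X j) \<in> borel_measurable (\<Pi>\<^sub>M i\<in>{..<n}. M)"
  unfolding emp_mean_def by measurable

lemma emp_mean_bounds: "0 \<le> emp_mean n X j" "emp_mean n X j \<le> 1"
proof -
  have "(\<Sum>i<n. of_bool (X i j) :: real) \<le> (\<Sum>i<n. 1)"
    by (intro sum_mono) auto
  then show "0 \<le> emp_mean n X j" "emp_mean n X j \<le> 1"
    unfolding emp_mean_def by (auto simp: divide_simps intro!: sum_nonneg)
qed

lemma deviation_le_1: "\<bar>emp_mean n X j - mean M j\<bar> \<le> 1"
  using emp_mean_bounds[of n X j] mean_bounds[of j] by auto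

lemma bdd_above_deviation: "bdd_above (range (\<lambda>j. \<bar>emp_mean n X j - mean M j\<bar>))"
  using deviation_le_1 by (auto intro!: bdd_aboveI[of _ 1])

lemma measurable_SUP_deviation[measurable]:
  "(\<lambda>X. SUP j. \<bar>emp_mean n X j - mean M j\<bar>) \<in> borel_measurable (\<Pi>\<^sub>M i\<in>{..<n}. M)"
  by (intro borel_measurable_cSUP bdd_above_deviation) auto

lemma SUP_deviation_bounds:
  "0 \<le> (SUP j. \<bar>emp_mean n X j - mean M j\<bar>)" "(SUP j. \<bar>emp_mean n X j - mean M j\<bar>) \<le> 1"
proof -
  show "0 \<le> (SUP j. \<bar>emp_mean n X j - mean M j\<bar>)"
    by (rule order_trans[OF abs_ge_zero cSUP_upper[OF UNIV_I bdd_above_deviation]])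
qed (auto intro!: cSUP_least deviation_le_1)

lemma nn_integral_exp_coord:
  "(\<integral>\<^sup>+x. ennreal (exp (\<theta> * (of_bool (x j) - mean M j))) \<partial>M)
    \<le> ennreal (exp (fold_half (mean M) j * (exp \<bar>\<theta>\<bar> - 1 - \<bar>\<theta>\<bar>)))"
proof -
  let ?p = "mean M j"
  \<comment> \<open>Only the values 0 and 1 occur, so the exponential is affine in
    \<open>of_bool (x j)\<close> and its integral depends on the mean alone.\<close>
  have eq: "exp (\<theta> * (of_bool (x j) - ?p))
      = exp (- (\<theta> * ?p)) * (1 + of_bool (x j) * (exp \<theta> - 1))" for x :: "nat \<Rightarrow> bool"
    by (auto simp: exp_diff exp_minus algebra_simps divide_simps)
  have int: "integrable M (\<lambda>x. of_bool (x j) :: real)"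
    by (intro integrable_const_bound[of _ 1]) auto
  have "(\<integral>\<^sup>+x. ennreal (exp (\<theta> * (of_bool (x j) - ?p))) \<partial>M)
      = ennreal (\<integral>x. exp (\<theta> * (of_bool (x j) - ?p)) \<partial>M)"
  proof (rule nn_integral_eq_integral)
    show "integrable M (\<lambda>x. exp (\<theta> * (of_bool (x j) - ?p)))"
      unfolding eq using int by simp
  qed simp
  also have "(\<integral>x. exp (\<theta> * (of_bool (x j) - ?p)) \<partial>M) = exp (- (\<theta> * ?p)) * (1 + ?p * (exp \<theta> - 1))"
    unfolding eq using int by (simp add: mean_def prob_space)
  also have "\<dots> \<le> exp (fold_half (mean M) j * (exp \<bar>\<theta>\<bar> - 1 - \<bar>\<theta>\<bar>))"
    unfolding fold_half_def using mean_bounds[of j] by (intro centered_exp_le)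
  finally show ?thesis
    by (simp add: ennreal_leI)
qed

lemma nn_integral_exp_emp_mean:
  assumes "n > 0"
  shows "(\<integral>\<^sup>+X. ennreal (exp (real n * \<theta> * (emp_mean n X j - mean M j))) \<partial>(\<Pi>\<^sub>M i\<in>{..<n}. M))
    \<le> ennreal (exp (real n * (fold_half (mean M) j * (exp \<bar>\<theta>\<bar> - 1 - \<bar>\<theta>\<bar>))))"
proof -
  have eq: "ennreal (exp (real n * \<theta> * (emp_mean n X j - mean M j)))
      = (\<Prod>i<n. ennreal (exp (\<theta> * (of_bool (X i j) - mean M j))))" for X
  proof -
    have "real n * \<theta> * (emp_mean n X j - mean M j) = (\<Sum>i<n. \<theta> * (of_bool (X i j) - mean M j))"
      using assms by (simp add: emp_mean_def sum_subtractf sum_distrib_left[symmetric] algebra_simps)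
    then show ?thesis
      by (simp add: exp_sum prod_ennreal)
  qed
  have "(\<integral>\<^sup>+X. ennreal (exp (real n * \<theta> * (emp_mean n X j - mean M j))) \<partial>(\<Pi>\<^sub>M i\<in>{..<n}. M))
      = (\<Prod>i<n. \<integral>\<^sup>+x. ennreal (exp (\<theta> * (of_bool (x j) - mean M j))) \<partial>M)"
    unfolding eq
    by (rule product_nn_integral_prod[where I = "{..<n}"
          and f = "\<lambda>_ x. ennreal (exp (\<theta> * (of_bool (x j) - mean M j)))"]) auto
  also have "\<dots> \<le> (\<Prod>i<n. ennreal (exp (fold_half (mean M) j * (exp \<bar>\<theta>\<bar> - 1 - \<bar>\<theta>\<bar>))))"
    using nn_integral_exp_coord by (intro prod_mono_ennreal) auto
  also have "\<dots> = ennreal (exp (real n * (fold_half (mean M) j * (exp \<bar>\<theta>\<bar> - 1 - \<bar>\<theta>\<bar>))))"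
    by (simp add: ennreal_power exp_of_nat_mult[symmetric])
  finally show ?thesis .
qed

text \<open>Since \<open>ennreal\<close> sends negative numbers to 0, the integrand is the positive
  part of the excess over \<open>s\<close>. It is bounded by \<open>y \<le> exp (l * y) / l\<close>
  with \<open>l = n * \<theta>\<close>, and \<open>exp (l * \<bar>Y\<bar>)\<close> is at most the
  sum of the exponentials at \<open>l * Y\<close> and \<open>- l * Y\<close>; this sum gives the
  factor 2.\<close>

lemma expected_excess_le:
  assumes "n > 0" "\<theta> > 0"
  shows "(\<integral>\<^sup>+X. ennreal (\<bar>emp_mean n X j - mean M j\<bar> - s) \<partial>(\<Pi>\<^sub>M i\<in>{..<n}. M))
    \<le> ennreal (2 / (real n * \<theta>)
        * exp (real n * (fold_half (mean M) j * (exp \<theta> - 1 - \<theta>) - \<theta> * s)))"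
proof -
  let ?P = "\<Pi>\<^sub>M i\<in>{..<n}. M" and ?l = "real n * \<theta>"
  let ?B = "exp (real n * (fold_half (mean M) j * (exp \<theta> - 1 - \<theta>)))"
  define a where "a = exp (- ?l * s) / ?l"
  have l: "?l > 0"
    using assms by simp
  have a: "a > 0"
    unfolding a_def using l by (intro divide_pos_pos) auto
  define Y where "Y X = emp_mean n X j - mean M j" for X
  have [measurable]: "Y \<in> borel_measurable ?P"
    unfolding Y_def by measurable
  have le: "ennreal (\<bar>Y X\<bar> - s)
      \<le> ennreal a * (ennreal (exp (?l * Y X)) + ennreal (exp (?l * (- Y X))))" for X
  proof -
    have "\<bar>Y X\<bar> - s \<le> exp (?l * (\<bar>Y X\<bar> - s)) / ?l"
      using exp_ge_add_one_self[of "?l * (\<bar>Y X\<bar> - s)"] l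
      by (subst pos_le_divide_eq) (linarith | simp only: mult.commute[of _ "?l"])+
    also have "\<dots> = a * exp (?l * \<bar>Y X\<bar>)"
      by (simp add: a_def exp_add[symmetric] algebra_simps)
    also have "\<dots> \<le> a * (exp (?l * Y X) + exp (?l * (- Y X)))"
      using a by (intro mult_left_mono) (auto simp: abs_if)
    finally show ?thesis
      using a by (simp flip: ennreal_plus ennreal_mult add: ennreal_leI)
  qed
  have "(\<integral>\<^sup>+X. ennreal (\<bar>Y X\<bar> - s) \<partial>?P)
      \<le> (\<integral>\<^sup>+X. ennreal a * (ennreal (exp (?l * Y X)) + ennreal (exp (?l * (- Y X)))) \<partial>?P)"
    by (intro nn_integral_mono le)
  also have "\<dots> = ennreal a * ((\<integral>\<^sup>+X. ennreal (exp (?l * Y X)) \<partial>?P)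
      + (\<integral>\<^sup>+X. ennreal (exp (?l * (- Y X))) \<partial>?P))"
    by (simp add: nn_integral_cmult nn_integral_add)
  also have "\<dots> \<le> ennreal a * (ennreal ?B + ennreal ?B)"
  proof (intro mult_left_mono add_mono)
    have minus: "real n * (- \<theta>) * y = ?l * (- y)" for y
      by simp
    show "(\<integral>\<^sup>+X. ennreal (exp (?l * Y X)) \<partial>?P) \<le> ennreal ?B"
      using nn_integral_exp_emp_mean[OF assms(1), of \<theta> j] assms(2) by (simp add: Y_def)
    show "(\<integral>\<^sup>+X. ennreal (exp (?l * (- Y X))) \<partial>?P) \<le> ennreal ?B"
      using nn_integral_exp_emp_mean[OF assms(1), of "- \<theta>" j, unfolded minus] assms(2)
      by (simp add: Y_def)
  qed simp
  also have "\<dots> = ennreal (a * (2 * ?B))"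
    using a by (simp flip: ennreal_plus ennreal_mult)
  also have "a * (2 * ?B) = 2 / ?l * (exp (- ?l * s) * ?B)"
    by (simp add: a_def)
  also have "exp (- ?l * s) * ?B
      = exp (real n * (fold_half (mean M) j * (exp \<theta> - 1 - \<theta>) - \<theta> * s))"
    by (simp add: exp_add[symmetric] algebra_simps)
  finally show ?thesis
    by (simp add: Y_def)
qed

lemma ennreal_Delta:
  "ennreal (Delta n M) = (\<integral>\<^sup>+X. ennreal (SUP j. \<bar>emp_mean n X j - mean M j\<bar>) \<partial>(\<Pi>\<^sub>M i\<in>{..<n}. M))"
proof -
  interpret P: prob_space "\<Pi>\<^sub>M i\<in>{..<n}. M"
    by (rule prob_space_power)
  show ?thesis
    unfolding Delta_def using SUP_deviation_bounds
    by (intro nn_integral_eq_integral[symmetric] P.integrable_const_bound[of _ 1]) auto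
qed

lemma Delta_nonneg: "Delta n M \<ge> 0"
  unfolding Delta_def by (intro Bochner_Integration.integral_nonneg SUP_deviation_bounds)

text \<open>A supremum exceeds \<open>s\<close> by at most the sum of the individual excesses. Only
  marginal laws of the coordinates enter, so the bound holds under arbitrary dependence between
  coordinates.\<close>

lemma Delta_le_suminf:
  assumes "s \<ge> 0" "summable f" "\<And>j. f j \<ge> 0"
    and f: "\<And>j. (\<integral>\<^sup>+X. ennreal (\<bar>emp_mean n X j - mean M j\<bar> - s) \<partial>(\<Pi>\<^sub>M i\<in>{..<n}. M)) \<le> ennreal (f j)"
  shows "Delta n M \<le> s + (\<Sum>j. f j)"
proof -
  let ?P = "\<Pi>\<^sub>M i\<in>{..<n}. M"
  interpret P: prob_space ?P
    by (rule prob_space_power)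
  have le: "ennreal (SUP j. \<bar>emp_mean n X j - mean M j\<bar>)
      \<le> ennreal s + (\<Sum>j. ennreal (\<bar>emp_mean n X j - mean M j\<bar> - s))" for X
  proof -
    have "ennreal \<bar>emp_mean n X j - mean M j\<bar>
        \<le> ennreal s + (\<Sum>j. ennreal (\<bar>emp_mean n X j - mean M j\<bar> - s))" for j
    proof -
      have "ennreal \<bar>emp_mean n X j - mean M j\<bar>
          \<le> ennreal (s + max 0 (\<bar>emp_mean n X j - mean M j\<bar> - s))"
        by (intro ennreal_leI) auto
      also have "\<dots> = ennreal s + ennreal (\<bar>emp_mean n X j - mean M j\<bar> - s)"
        using assms(1) by (simp add: ennreal_plus max_def ennreal_neg)
      also have "\<dots> \<le> ennreal s + (\<Sum>j. ennreal (\<bar>emp_mean n X j - mean M j\<bar> - s))"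
        using sum_le_suminf[of "\<lambda>j. ennreal (\<bar>emp_mean n X j - mean M j\<bar> - s)" "{j}"]
        by (intro add_left_mono) auto
      finally show ?thesis .
    qed
    \<comment> \<open>If the right side is infinite the claim is trivial; otherwise it is a real
      upper bound for every term and hence for the supremum.\<close>
    then show ?thesis
      by (cases "ennreal s + (\<Sum>j. ennreal (\<bar>emp_mean n X j - mean M j\<bar> - s))")
        (auto intro!: cSUP_least simp: ennreal_le_iff)
  qed
  have "ennreal (Delta n M) \<le> (\<integral>\<^sup>+X. ennreal s + (\<Sum>j. ennreal (\<bar>emp_mean n X j - mean M j\<bar> - s)) \<partial>?P)"
    unfolding ennreal_Delta by (intro nn_integral_mono le)
  also have "\<dots> = ennreal s + (\<Sum>j. \<integral>\<^sup>+X. ennreal (\<bar>emp_mean n X j - mean M j\<bar> - s) \<partial>?P)"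
    by (subst nn_integral_add) (auto simp: nn_integral_suminf P.emeasure_space_1)
  also have "\<dots> \<le> ennreal s + (\<Sum>j. ennreal (f j))"
    by (intro add_left_mono suminf_le f) auto
  also have "\<dots> = ennreal (s + (\<Sum>j. f j))"
    using assms by (simp add: suminf_ennreal2 ennreal_plus suminf_nonneg)
  finally show ?thesis
    using assms by (subst (asm) ennreal_le_iff) (auto intro!: add_nonneg_nonneg suminf_nonneg)
qed

end

subsection \<open>The upper bound\<close>

text \<open>Comparison with the telescoping series of \<open>1 / (k + 1) - 1 / (k + 2)\<close>,
  whose sum is 1.\<close>

lemma inverse_squares_sum_le_1:
  "summable (\<lambda>k. 1 / (real k + 2)\<^sup>2)" "(\<Sum>k. 1 / (real k + 2)\<^sup>2) \<le> 1"
proof -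
  have tele: "(\<lambda>k. 1 / (real k + 1) - 1 / (real (Suc k) + 1)) sums (1 / (real 0 + 1) - 0)"
    by (intro telescope_sums') real_asymp
  have le: "1 / (real k + 2)\<^sup>2 \<le> 1 / (real k + 1) - 1 / (real (Suc k) + 1)" for k
    by (simp add: field_simps power2_eq_square)
      (intro divide_left_mono mult_pos_pos add_pos_nonneg, auto)
  show sm: "summable (\<lambda>k. 1 / (real k + 2)\<^sup>2)"
    by (rule summable_comparison_test'[OF sums_summable[OF tele], of 0]) (use le in auto)
  show "(\<Sum>k. 1 / (real k + 2)\<^sup>2) \<le> 1"
    using suminf_le[OF le sm sums_summable[OF tele]] sums_unique[OF tele] by simp
qed

text \<open>Injectivity turns each partial sum into a sum of \<open>1 / (k + 2)\<^sup>2\<close> over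
  distinct \<open>k\<close>. With \<open>A\<close> the set of coordinates of positive folded mean,
  this adds up the contributions of all ranked coordinates.\<close>

lemma suminf_rank_le:
  fixes r :: "nat \<Rightarrow> nat"
  assumes "inj_on r A"
  defines "g \<equiv> \<lambda>j. if j \<in> A then 1 / (real (r j) + 2)\<^sup>2 else 0"
  shows "summable g" "suminf g \<le> 1"
proof -
  have le: "sum g {..<m} \<le> 1" for m
  proof -
    have "sum g {..<m} = (\<Sum>j\<in>{..<m} \<inter> A. 1 / (real (r j) + 2)\<^sup>2)"
      unfolding g_def by (simp add: sum.inter_restrict)
    also have "\<dots> = (\<Sum>k\<in>r ` ({..<m} \<inter> A). 1 / (real k + 2)\<^sup>2)"
      using assms(1) by (subst sum.reindex) (auto intro: inj_on_subset)
    also have "\<dots> \<le> (\<Sum>k. 1 / (real k + 2)\<^sup>2)"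
      by (intro sum_le_suminf inverse_squares_sum_le_1) auto
    also have "\<dots> \<le> 1"
      by (rule inverse_squares_sum_le_1)
    finally show ?thesis .
  qed
  have "g j \<ge> 0" for j
    by (simp add: g_def)
  then show "summable g"
    using le by (intro summableI_nonneg_bounded)
  then show "suminf g \<le> 1"
    by (intro suminf_le_const le)
qed

text \<open>Gaussian regime. For \<open>\<theta> \<le> 1\<close> the exponent is at most
  \<open>n * (q * \<theta>\<^sup>2 - \<theta> * s)\<close>, whose minimum is
  \<open>- n * s\<^sup>2 / (4 * q) = - 9 * S / (4 * q)\<close>. The factor 3 in \<open>s\<close>
  makes \<open>9 / 4 \<ge> 2\<close>, so this is at most \<open>- 2 * ln R\<close>.\<close>

lemma large_coordinate_bound:
  fixes q S R :: real and n :: nat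
  assumes "n > 0" "S > 0" "R \<ge> 2" "q * ln R \<le> S"
  defines "s \<equiv> 3 * sqrt (S / real n)"
  assumes "q \<ge> s / 2"
  shows "\<exists>\<theta>>0. 2 / (real n * \<theta>) * exp (real n * (q * (exp \<theta> - 1 - \<theta>) - \<theta> * s))
    \<le> 8 / 3 * sqrt (S / real n) / R\<^sup>2"
proof (intro exI conjI)
  \<comment> \<open>The minimizer of \<open>q * \<theta>\<^sup>2 - \<theta> * s\<close>; the
    hypothesis \<open>q \<ge> s / 2\<close> says exactly that it is at most 1.\<close>
  define \<theta> where "\<theta> = s / (2 * q)"
  have s: "s > 0" "real n * s\<^sup>2 = 9 * S"
    unfolding s_def using assms(1,2) by (auto simp: power_mult_distrib)
  have q: "q > 0"
    using assms(6) s by simp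
  show \<theta>: "\<theta> > 0"
    unfolding \<theta>_def using s q by simp
  have "\<theta> \<le> 1"
    unfolding \<theta>_def using assms(6) q by simp
  then have "exp \<theta> - 1 - \<theta> \<le> \<theta>\<^sup>2"
    using exp_bound[of \<theta>] \<theta> by simp
  then have "q * (exp \<theta> - 1 - \<theta>) \<le> q * \<theta>\<^sup>2"
    using q by simp
  also have "q * \<theta>\<^sup>2 = s\<^sup>2 / (4 * q)"
    unfolding \<theta>_def using q by (simp add: power2_eq_square)
  finally have "real n * (q * (exp \<theta> - 1 - \<theta>) - \<theta> * s) \<le> real n * (s\<^sup>2 / (4 * q) - \<theta> * s)"
    by (intro mult_left_mono) auto
  also have "\<dots> = - (real n * s\<^sup>2) / (4 * q)"
    unfolding \<theta>_def using q by (simp add: field_simps power2_eq_square)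
  also have "\<dots> \<le> - 2 * ln R"
    unfolding s using assms(4) q assms(2) by (simp add: field_simps)
  finally have "exp (real n * (q * (exp \<theta> - 1 - \<theta>) - \<theta> * s)) \<le> exp (- 2 * ln R)"
    by simp
  also have "exp (- 2 * ln R) = 1 / R\<^sup>2"
    using assms(3) by (simp add: exp_minus exp_double divide_simps)
  finally have exp_le: "exp (real n * (q * (exp \<theta> - 1 - \<theta>) - \<theta> * s)) \<le> 1 / R\<^sup>2" .
  \<comment> \<open>With \<open>q * ln R \<le> S\<close> this yields \<open>q \<le> 2 * S\<close>,
    which removes \<open>q\<close> from the prefactor \<open>4 * q / (n * s)\<close>.\<close>
  have "ln R \<ge> 1 / 2"
  proof -
    have "exp (1 / 2 :: real) \<le> 1 + 1 / 2 + (1 / 2)\<^sup>2"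
      by (intro exp_bound) auto
    also have "\<dots> \<le> R"
      using assms(3) by (simp add: power2_eq_square)
    finally show ?thesis
      using assms(3) by (subst ln_ge_iff) auto
  qed
  then have "q * (1 / 2) \<le> q * ln R"
    using q by (intro mult_left_mono) auto
  then have "q \<le> 2 * S"
    using assms(4) by simp
  have "2 / (real n * \<theta>) = 4 * q / (real n * s)"
    unfolding \<theta>_def using q s by (simp add: field_simps)
  also have "\<dots> \<le> 4 * (2 * S) / (real n * s)"
    using \<open>q \<le> 2 * S\<close> s assms(1) by (intro divide_right_mono) auto
  also have "\<dots> = 8 / 3 * sqrt (S / real n)"
    using s assms(1) unfolding s_def by (auto simp: field_simps real_sqrt_divide)
  finally have "2 / (real n * \<theta>) \<le> 8 / 3 * sqrt (S / real n)" .
  from mult_mono[OF this exp_le]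
  show "2 / (real n * \<theta>) * exp (real n * (q * (exp \<theta> - 1 - \<theta>) - \<theta> * s))
    \<le> 8 / 3 * sqrt (S / real n) / R\<^sup>2"
    using assms(2) by simp
qed

text \<open>Poisson regime. The hypothesis on \<open>T\<close> turns a power of \<open>q\<close>
  into a power of \<open>R\<close>, so it is enough to push the exponent below
  \<open>2 * T * ln q\<close>. Whether \<open>q\<close> lies above or below
  \<open>(s / 2)\<^sup>2\<close> decides between a constant \<theta> and one growing like
  \<open>ln (1 / q)\<close>.\<close>

lemma small_coordinate_bound:
  fixes q s R T :: real and n :: nat
  assumes "n > 0" "R > 0" "T > 0" "0 < q" "ln R \<le> T * ln (1 / q)" "0 < s" "q < s / 2"
    and s_small: "s \<le> 1 / 2"
    and ns_large: "8 * T \<le> real n * s"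
    and poly: "- (real n * s / 2) \<le> 4 * T * ln (s / 2)"
  shows "\<exists>\<theta>>0. 2 / (real n * \<theta>) * exp (real n * (q * (exp \<theta> - 1 - \<theta>) - \<theta> * s))
    \<le> 2 / real n / R\<^sup>2"
proof -
  have suff: ?thesis if "\<theta> \<ge> 1" "real n * (q * (exp \<theta> - 1 - \<theta>) - \<theta> * s) \<le> 2 * T * ln q" for \<theta>
  proof (intro exI conjI)
    have "2 * T * ln q \<le> - 2 * ln R"
      using assms(4,5) by (simp add: ln_div)
    then have "exp (real n * (q * (exp \<theta> - 1 - \<theta>) - \<theta> * s)) \<le> exp (- 2 * ln R)"
      using that(2) by simp
    also have "\<dots> = 1 / R\<^sup>2"
      using assms(2) by (simp add: exp_minus exp_double divide_simps)
    finally have e: "exp (real n * (q * (exp \<theta> - 1 - \<theta>) - \<theta> * s)) \<le> 1 / R\<^sup>2" .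
    have "2 / (real n * \<theta>) \<le> 2 / real n"
      using that(1) assms(1) by (intro divide_left_mono) auto
    from mult_mono[OF this e]
    show "2 / (real n * \<theta>) * exp (real n * (q * (exp \<theta> - 1 - \<theta>) - \<theta> * s)) \<le> 2 / real n / R\<^sup>2"
      by simp
    show "\<theta> > 0"
      using that(1) by simp
  qed
  show ?thesis
  proof (cases "q \<ge> (s / 2)\<^sup>2")
    case True
    show ?thesis
    \<comment> \<open>Here \<open>q\<close> is at least polynomial in \<open>s\<close>, so
      \<open>ln q\<close> is controlled by \<open>ln (s / 2)\<close>, and the decay
      \<open>exp (- n * s / 2)\<close> suffices by \<open>poly\<close>.\<close>
    proof (rule suff[of 1])
      have "exp 1 - 2 \<le> (1 :: real)"
        using e_less_272 by simp
      then have "q * (exp 1 - 1 - 1) \<le> q * 1"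
        using assms(4) by (intro mult_left_mono) auto
      then have "q * (exp 1 - 1 - 1) - 1 * s \<le> - (s / 2)"
        using assms(7) by simp
      then have "real n * (q * (exp 1 - 1 - 1) - 1 * s) \<le> real n * (- (s / 2))"
        by (intro mult_left_mono) auto
      also have "\<dots> = - (real n * s / 2)"
        by simp
      also have "\<dots> \<le> 4 * T * ln (s / 2)"
        by (rule poly)
      also have "\<dots> = 2 * T * ln ((s / 2)\<^sup>2)"
        using assms(6) by (simp add: ln_realpow)
      also have "\<dots> \<le> 2 * T * ln q"
        using True assms(3,4,6) by (intro mult_left_mono) auto
      finally show "real n * (q * (exp 1 - 1 - 1) - 1 * s) \<le> 2 * T * ln q" .
    qed simp
  next
    case False
    \<comment> \<open>Chosen so that \<open>q * exp \<theta> = sqrt q \<le> s / 2\<close>; the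
      linear term \<open>- \<theta> * s\<close> then dominates, and \<open>ns_large\<close> makes
      the exponent at most \<open>- 4 * T * \<theta> = 2 * T * ln q\<close>.\<close>
    define \<theta> where "\<theta> = - ln q / 2"
    have sq: "sqrt q \<le> s / 2"
      using False assms(6) by (intro real_le_lsqrt) auto
    have e\<theta>: "exp \<theta> = 1 / sqrt q"
    proof -
      have "exp \<theta> = exp (- ln (sqrt q))"
        unfolding \<theta>_def using assms(4) by (simp add: ln_sqrt)
      then show ?thesis
        using assms(4) by (simp add: exp_minus inverse_eq_divide)
    qed
    have "exp 1 \<le> (4 :: real)"
      using e_less_272 by simp
    also have "4 \<le> 1 / sqrt q"
      using sq s_small assms(4) by (simp add: field_simps)
    finally have \<theta>: "\<theta> \<ge> 1"
      unfolding e\<theta>[symmetric] by simp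
    show ?thesis
    proof (rule suff[OF \<theta>])
      have "q * (exp \<theta> - 1 - \<theta>) \<le> q * exp \<theta>"
        using assms(4) \<theta> by (intro mult_left_mono) auto
      also have "\<dots> = sqrt q"
        using assms(4) by (simp add: e\<theta> real_div_sqrt)
      also have "\<dots> \<le> s / 2 * \<theta>"
        using sq mult_left_mono[OF \<theta>, of "s / 2"] assms(6) by linarith
      finally have "q * (exp \<theta> - 1 - \<theta>) - \<theta> * s \<le> s / 2 * \<theta> - \<theta> * s"
        by (simp only: diff_right_mono)
      also have "\<dots> = - (s * \<theta> / 2)"
        by (simp add: field_simps)
      finally have "real n * (q * (exp \<theta> - 1 - \<theta>) - \<theta> * s) \<le> real n * (- (s * \<theta> / 2))"
        by (intro mult_left_mono) auto
      also have "\<dots> = - (real n * s * (\<theta> / 2))"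
        by simp
      also have "\<dots> \<le> - (8 * T * (\<theta> / 2))"
        using ns_large \<theta> mult_right_mono[of "8 * T" "real n * s" "\<theta> / 2"] by simp
      also have "\<dots> = 2 * T * ln q"
        by (simp add: \<theta>_def)
      finally show "real n * (q * (exp \<theta> - 1 - \<theta>) - \<theta> * s) \<le> 2 * T * ln q" .
    qed
  qed
qed

text \<open>With \<open>s\<close> of order \<open>1 / sqrt n\<close>, the product
  \<open>n * s\<close> grows like \<open>sqrt n\<close> and outweighs both constants and
  \<open>ln (1 / s)\<close>.\<close>

lemma eventually_small_coordinate_conditions:
  fixes S T :: real
  assumes "S > 0" "T > 0"
  shows "\<forall>\<^sub>F n in sequentially. 3 * sqrt (S / real n) \<le> 1 / 2"
    and "\<forall>\<^sub>F n in sequentially. 8 * T \<le> real n * (3 * sqrt (S / real n))"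
    and "\<forall>\<^sub>F n in sequentially.
      - (real n * (3 * sqrt (S / real n)) / 2) \<le> 4 * T * ln (3 * sqrt (S / real n) / 2)"
  using assms by real_asymp+

section \<open>Summing the coordinate bounds and passing to the limit\<close>

context cube_measure
begin

text \<open>Coordinates of folded mean 0 receive no rank. For them the exponent is
  \<open>- n * \<theta> * s\<close>, and letting \<theta> tend to infinity removes the
  excess.\<close>

lemma expected_excess_null:
  assumes "n > 0" "s > 0" "fold_half (mean M) j = 0"
  shows "(\<integral>\<^sup>+X. ennreal (\<bar>emp_mean n X j - mean M j\<bar> - s) \<partial>(\<Pi>\<^sub>M i\<in>{..<n}. M)) = 0"
proof -
  have "((\<lambda>\<theta>. 2 / (real n * \<theta>) * exp (- (real n * (\<theta> * s)))) \<longlongrightarrow> 0) at_top"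
    using assms(1,2) by real_asymp
  then have "((\<lambda>\<theta>. ennreal (2 / (real n * \<theta>) * exp (- (real n * (\<theta> * s))))) \<longlongrightarrow> ennreal 0) at_top"
    by (rule tendsto_ennrealI)
  moreover have "\<forall>\<^sub>F \<theta> in at_top. (\<integral>\<^sup>+X. ennreal (\<bar>emp_mean n X j - mean M j\<bar> - s) \<partial>(\<Pi>\<^sub>M i\<in>{..<n}. M))
      \<le> ennreal (2 / (real n * \<theta>) * exp (- (real n * (\<theta> * s))))"
    using eventually_gt_at_top[of "0 :: real"]
  proof eventually_elim
    case (elim \<theta>)
    then show ?case
      using expected_excess_le[OF assms(1), of \<theta> j s] assms(3) by simp
  qed
  ultimately have "(\<integral>\<^sup>+X. ennreal (\<bar>emp_mean n X j - mean M j\<bar> - s) \<partial>(\<Pi>\<^sub>M i\<in>{..<n}. M)) \<le> ennreal 0"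
    by (rule tendsto_lowerbound) simp
  then show ?thesis
    by simp
qed

lemma Delta_upper_bound:
  fixes r :: "nat \<Rightarrow> nat" and S T :: real and n :: nat
  defines "q \<equiv> fold_half (mean M)" and "s \<equiv> 3 * sqrt (S / real n)"
  assumes "n > 0" "S > 0" "T > 0" and inj: "inj_on r {j. q j > 0}"
    and S: "\<And>j. q j > 0 \<Longrightarrow> q j * ln (real (r j) + 2) \<le> S"
    and T: "\<And>j. q j > 0 \<Longrightarrow> ln (real (r j) + 2) \<le> T * ln (1 / q j)"
    and s: "s \<le> 1 / 2" "8 * T \<le> real n * s" "- (real n * s / 2) \<le> 4 * T * ln (s / 2)"
  shows "Delta n M \<le> 6 * sqrt (S / real n) + 2 / real n"
proof -
  \<comment> \<open>The sum of the prefactors of the two regimes, so that one summable sequence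
    \<open>C * g j\<close> serves both.\<close>
  define C where "C = 8 / 3 * sqrt (S / real n) + 2 / real n"
  define g where "g j = (if j \<in> {j. q j > 0} then 1 / (real (r j) + 2)\<^sup>2 else 0)" for j
  have C: "C \<ge> 0"
    unfolding C_def using assms(4) by simp
  have s_pos: "s > 0"
    unfolding s_def using assms(3,4) by simp
  have g: "summable g" "suminf g \<le> 1" "\<And>j. g j \<ge> 0"
    using suminf_rank_le[OF inj] unfolding g_def by auto
  have "Delta n M \<le> s + (\<Sum>j. C * g j)"
  proof (rule Delta_le_suminf)
    fix j
    show "(\<integral>\<^sup>+X. ennreal (\<bar>emp_mean n X j - mean M j\<bar> - s) \<partial>(\<Pi>\<^sub>M i\<in>{..<n}. M)) \<le> ennreal (C * g j)"
    proof (cases "q j > 0")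
      case False
      then have "fold_half (mean M) j = 0"
        using fold_half_mean_bounds[of j] by (simp add: q_def)
      then show ?thesis
        using expected_excess_null[OF assms(3) s_pos] by simp
    next
      case True
      have "\<exists>\<theta>>0. 2 / (real n * \<theta>) * exp (real n * (q j * (exp \<theta> - 1 - \<theta>) - \<theta> * s)) \<le> C * g j"
      proof (cases "q j \<ge> s / 2")
        case large: True
        have "8 / 3 * sqrt (S / real n) * g j \<le> C * g j"
          using g(3) by (intro mult_right_mono) (auto simp: C_def)
        moreover have "\<exists>\<theta>>0. 2 / (real n * \<theta>) * exp (real n * (q j * (exp \<theta> - 1 - \<theta>) - \<theta> * s))
            \<le> 8 / 3 * sqrt (S / real n) / (real (r j) + 2)\<^sup>2"
          using large_coordinate_bound[of n S "real (r j) + 2" "q j"] assms(3,4) S[OF True] large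
          unfolding s_def by simp
        ultimately show ?thesis
          using True by (fastforce simp: g_def)
      next
        case False
        have "2 / real n * g j \<le> C * g j"
          using g(3) assms(4) by (intro mult_right_mono) (auto simp: C_def)
        moreover have "\<exists>\<theta>>0. 2 / (real n * \<theta>) * exp (real n * (q j * (exp \<theta> - 1 - \<theta>) - \<theta> * s))
            \<le> 2 / real n / (real (r j) + 2)\<^sup>2"
          using small_coordinate_bound[of n "real (r j) + 2" T "q j" s] assms(3,5) T[OF True] True
            s s_pos False by simp
        ultimately show ?thesis
          using True by (fastforce simp: g_def)
      qed
      then obtain \<theta> where "\<theta> > 0"
        "2 / (real n * \<theta>) * exp (real n * (q j * (exp \<theta> - 1 - \<theta>) - \<theta> * s)) \<le> C * g j"
        by blast
      then show ?thesis
        using expected_excess_le[OF assms(3), of \<theta> j s] unfolding q_def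
        by (meson ennreal_leI order_trans)
    qed
  qed (use s_pos g C in auto)
  also have "(\<Sum>j. C * g j) = C * suminf g"
    using g(1) by (rule suminf_mult)
  also have "\<dots> \<le> C"
    using mult_left_mono[OF g(2) C] by simp
  finally have "Delta n M \<le> s + C"
    by simp
  \<comment> \<open>The constant 6 comes from \<open>3 + 8 / 3 \<le> 6\<close>: the level
    \<open>s\<close> plus the Gaussian part of \<open>C\<close>.\<close>
  moreover have "sqrt (S / real n) \<ge> 0"
    using assms(4) by simp
  ultimately show ?thesis
    unfolding s_def C_def by linarith
qed

text \<open>After scaling by \<open>sqrt n\<close>, the Poisson term \<open>2 / n\<close> vanishes
  in the limit, so \<open>T\<close> must be finite but leaves no trace in the bound. The map
  \<open>r\<close> is arbitrary: the product case takes \<open>id\<close>, the general case a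
  decreasing rank.\<close>

lemma limsup_Delta_le:
  fixes r :: "nat \<Rightarrow> nat" and S T :: real
  defines "q \<equiv> fold_half (mean M)"
  assumes "S \<ge> 0" "T \<ge> 0" and inj: "inj_on r {j. q j > 0}"
    and S: "\<And>j. q j > 0 \<Longrightarrow> q j * ln (real (r j) + 2) \<le> S"
    and T: "\<And>j. q j > 0 \<Longrightarrow> ln (real (r j) + 2) \<le> T * ln (1 / q j)"
  shows "limsup (\<lambda>n. ereal (sqrt (real n) * Delta n M)) \<le> ereal (6 * sqrt S)"
proof -
  \<comment> \<open>Passing to \<open>S' > S\<close> and \<open>T + 1\<close> covers the degenerate cases \<open>S = 0\<close> and \<open>T = 0\<close>.\<close>
  have le: "limsup (\<lambda>n. ereal (sqrt (real n) * Delta n M)) \<le> ereal (6 * sqrt S')" if "S' > S" for S'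
  proof -
    have S': "S' > 0"
      using that assms(2) by simp
    have T': "T + 1 > 0"
      using assms(3) by simp
    have T1: "ln (real (r j) + 2) \<le> (T + 1) * ln (1 / q j)" if "q j > 0" for j
    proof -
      have "ln (1 / q j) \<ge> 0"
        using that fold_half_mean_bounds[of j] by (simp add: q_def ln_div)
      then show ?thesis
        using T[OF that] by (simp add: distrib_right)
    qed
    have S1: "q j * ln (real (r j) + 2) \<le> S'" if "q j > 0" for j
      using S[OF that] \<open>S' > S\<close> by simp
    have "\<forall>\<^sub>F n in sequentially. Delta n M \<le> 6 * sqrt (S' / real n) + 2 / real n"
      using eventually_small_coordinate_conditions[OF S' T'] eventually_gt_at_top[of 0]
    proof eventually_elim
      case (elim n)
      show ?case
        by (rule Delta_upper_bound[of n S' "T + 1" r])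
          (use elim S' T' S1 T1 inj in \<open>auto simp: q_def\<close>)
    qed
    then have "\<forall>\<^sub>F n in sequentially.
        ereal (sqrt (real n) * Delta n M) \<le> ereal (6 * sqrt S' + 2 / sqrt (real n))"
      using eventually_gt_at_top[of 0]
    proof eventually_elim
      case (elim n)
      have "sqrt (real n) * Delta n M \<le> sqrt (real n) * (6 * sqrt (S' / real n) + 2 / real n)"
        using elim by (intro mult_left_mono) auto
      also have "\<dots> = 6 * sqrt S' + 2 / sqrt (real n)"
        using elim by (simp add: real_sqrt_divide field_simps)
      finally show ?case by simp
    qed
    then have "limsup (\<lambda>n. ereal (sqrt (real n) * Delta n M))
        \<le> limsup (\<lambda>n. ereal (6 * sqrt S' + 2 / sqrt (real n)))"
      by (rule Limsup_mono)
    also have "\<dots> = ereal (6 * sqrt S')"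
    proof (rule lim_imp_Limsup)
      have "(\<lambda>n. 2 / sqrt (real n)) \<longlonglongrightarrow> 0"
        by real_asymp
      from tendsto_add[OF tendsto_const[of "6 * sqrt S'"] this]
      show "(\<lambda>n. ereal (6 * sqrt S' + 2 / sqrt (real n))) \<longlonglongrightarrow> ereal (6 * sqrt S')"
        by simp
    qed simp
    finally show ?thesis .
  qed
  have "((\<lambda>S'. ereal (6 * sqrt S')) \<longlongrightarrow> ereal (6 * sqrt S)) (at_right S)"
    by (intro tendsto_intros)
  then show ?thesis
    by (rule tendsto_lowerbound) (use le in \<open>auto simp: eventually_at_filter\<close>)
qed

end

section \<open>Ranks and the decreasing rearrangement\<close>

text \<open>
  The rank, with ties broken by the index, replaces an explicit sorting permutation, which need not
  exist when \<open>q\<close> has zeros.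
\<close>

lemma decreasing_rank_exists:
  fixes q :: "nat \<Rightarrow> real"
  assumes "q \<longlonglongrightarrow> 0"
  shows "\<exists>r :: nat \<Rightarrow> nat. inj_on r {j. q j > 0} \<and> (\<forall>j. q j > 0 \<longrightarrow> q j \<le> rearrangement q (r j))"
proof -
  \<comment> \<open>The strict predecessors of \<open>j\<close> when larger values come first. Their
    number is the 0-based rank; it increases strictly along this total order, which gives
    injectivity.\<close>
  define P where "P j = {i. q j < q i \<or> q i = q j \<and> i < j}" for j
  have sub: "P j \<subseteq> {i. q i \<ge> q j} - {j}" for j
    unfolding P_def by auto
  have fin: "finite (P j)" if "q j > 0" for j
    using null_seq_level_finite[OF assms that] sub finite_subset by blast
  have lt: "card (P i) < card (P j)" if "q i > 0" "q j > 0" "i \<in> P j" for i j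
  proof (rule psubset_card_mono)
    show "P i \<subset> P j"
      using that(3) unfolding P_def by auto
  qed (use fin that in auto)
  have "inj_on (\<lambda>j. card (P j)) {j. q j > 0}"
  proof (rule inj_onI, rule ccontr)
    fix i j
    assume ij: "i \<in> {j. q j > 0}" "j \<in> {j. q j > 0}" "card (P i) = card (P j)" "i \<noteq> j"
    then have "i \<in> P j \<or> j \<in> P i"
      unfolding P_def by auto
    then show False
      using lt[of i j] lt[of j i] ij by auto
  qed
  moreover have "q j \<le> rearrangement q (card (P j))" if "q j > 0" for j
  proof -
    \<comment> \<open>Strict because \<open>j\<close> itself lies in the level set but not in
      \<open>P j\<close>; this is the form required by \<open>rearrangement_ge_iff\<close>.\<close>
    have "card (P j) < card {i. q i \<ge> q j}"
      using null_seq_level_finite[OF assms that] sub[of j]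
      by (intro psubset_card_mono) auto
    then show ?thesis
      using rearrangement_ge_iff[OF assms that] by simp
  qed
  ultimately show ?thesis
    by (intro exI[of _ "\<lambda>j. card (P j)"]) auto
qed

lemma rearrangement_le:
  fixes q :: "nat \<Rightarrow> real"
  assumes "q \<longlonglongrightarrow> 0" "\<And>i. q i \<le> B" "B > 0"
  shows "rearrangement q j \<le> B"
proof (rule ccontr)
  assume *: "\<not> rearrangement q j \<le> B"
  then have "j < card {i. q i \<ge> rearrangement q j}"
    using rearrangement_ge_iff[OF assms(1), of "rearrangement q j" j] assms(3) by simp
  moreover have "{i. q i \<ge> rearrangement q j} = {}"
    using assms(2) * by (auto simp: not_le intro: le_less_trans)
  ultimately show False
    by simp
qed

lemma T_seq_upper:
  assumes "T_seq p < \<infinity>"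
  obtains T where "T \<ge> 0"
    "\<And>j. 0 < p j \<Longrightarrow> p j \<le> 1 / 2 \<Longrightarrow> ln (real j + 2) \<le> T * ln (1 / p j)"
proof -
  define f where "f j = (if p j = 0 then 0 else ln (real j + 2) / ln (1 / p j))" for j
  obtain T where T: "T_seq p \<le> ereal T"
    using assms by (cases "T_seq p") auto
  have f: "f j \<le> T" for j
  proof -
    have "ereal (f j) \<le> T_seq p"
      unfolding T_seq_def f_def by (intro SUP_upper) auto
    with T show ?thesis
      by (metis ereal_less_eq(3) order_trans)
  qed
  show ?thesis
  proof
    show "max T 0 \<ge> 0"
      by simp
    fix j
    assume j: "0 < p j" "p j \<le> 1 / 2"
    then have pos: "ln (1 / p j) > 0"
      by (intro ln_gt_zero) (simp add: field_simps)
    have "ln (real j + 2) = f j * ln (1 / p j)"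
      using j pos by (simp add: f_def)
    also have "\<dots> \<le> max T 0 * ln (1 / p j)"
      using f[of j] pos by (intro mult_right_mono) auto
    finally show "ln (real j + 2) \<le> max T 0 * ln (1 / p j)" .
  qed
qed

lemma S_seq_cases:
  assumes "\<And>j. p j \<ge> 0"
  obtains "S_seq p = \<infinity>" | S where "S_seq p = ereal S" "S \<ge> 0" "\<And>j. p j * ln (real j + 2) \<le> S"
proof -
  have nonneg: "0 \<le> p j * ln (real j + 2)" for j
    using assms by simp
  have up: "ereal (p j * ln (real j + 2)) \<le> S_seq p" for j
    unfolding S_seq_def by (intro SUP_upper) auto
  have "0 \<le> S_seq p"
    using order_trans[OF _ up[of 0], of 0] nonneg[of 0] by simp
  then show ?thesis
    using that up by (cases "S_seq p") auto
qed

text \<open>Both \<open>x * ln (k + 2) \<le> S\<close> and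
  \<open>ln (k + 2) \<le> T * ln (1 / x)\<close> persist when \<open>x\<close> decreases. Hence the
  bounds for the rearrangement \<open>R\<close> at \<open>r j\<close> pass to \<open>q j\<close>,
  which is at most \<open>R (r j)\<close>.\<close>

lemma limsup_Delta_le_S_meas:
  assumes "prob_on_cube M" "T_meas M < \<infinity>"
  shows "limsup (\<lambda>n. ereal (sqrt (real n) * Delta n M)) \<le> ereal 6 * esqrt (S_meas M)"
proof -
  interpret cube_measure M
    using assms(1) unfolding prob_on_cube_def cube_measure_def cube_measure_axioms_def by auto
  define q where "q = fold_half (mean M)"
  define R where "R = rearrangement q"
  have lim: "q \<longlonglongrightarrow> 0"
    using assms(2) by (auto simp: T_meas_def q_def split: if_splits)
  have q: "0 \<le> q j" "q j \<le> 1 / 2" for j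
    using fold_half_mean_bounds[of j] by (auto simp: q_def)
  have R: "0 \<le> R j" "R j \<le> 1 / 2" for j
    unfolding R_def using rearrangement_nonneg[OF lim q(1)] rearrangement_le[OF lim q(2)] by auto
  have SR: "S_meas M = S_seq R" and "T_meas M = T_seq R"
    using lim by (auto simp: S_meas_def T_meas_def R_def q_def)
  with assms(2) obtain T where T: "T \<ge> 0"
    "\<And>j. 0 < R j \<Longrightarrow> R j \<le> 1 / 2 \<Longrightarrow> ln (real j + 2) \<le> T * ln (1 / R j)"
    using T_seq_upper by metis
  obtain r :: "nat \<Rightarrow> nat" where r: "inj_on r {j. q j > 0}" "\<And>j. q j > 0 \<Longrightarrow> q j \<le> R (r j)"
    using decreasing_rank_exists[OF lim] unfolding R_def by auto
  consider (infinite) "S_seq R = \<infinity>"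
    | (finite) S where "S_seq R = ereal S" "S \<ge> 0" "\<And>j. R j * ln (real j + 2) \<le> S"
    using S_seq_cases[of R] R(1) by metis
  then show ?thesis
  proof cases
    case infinite
    then show ?thesis by (simp add: SR esqrt_def)
  next
    case (finite S)
    have "limsup (\<lambda>n. ereal (sqrt (real n) * Delta n M)) \<le> ereal (6 * sqrt S)"
    proof (rule limsup_Delta_le[where r = r and T = T])
      fix j
      assume j: "fold_half (mean M) j > 0"
      then have Rj: "0 < q j" "q j \<le> R (r j)"
        using r(2)[of j] by (auto simp: q_def)
      have "q j * ln (real (r j) + 2) \<le> R (r j) * ln (real (r j) + 2)"
        using Rj by (intro mult_right_mono) auto
      also have "\<dots> \<le> S"
        by (rule finite)
      finally show "fold_half (mean M) j * ln (real (r j) + 2) \<le> S"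
        by (simp add: q_def)
      have "ln (real (r j) + 2) \<le> T * ln (1 / R (r j))"
        using T(2) Rj R by simp
      also have "\<dots> \<le> T * ln (1 / q j)"
        using Rj T(1) by (intro mult_left_mono) (auto simp: ln_div)
      finally show "ln (real (r j) + 2) \<le> T * ln (1 / fold_half (mean M) j)"
        by (simp add: q_def)
    qed (use r(1) T(1) finite in \<open>auto simp: q_def\<close>)
    then show ?thesis
      by (simp add: SR finite esqrt_def)
  qed
qed

subsection \<open>Independent columns\<close>

text \<open>
  The entries of this array are independent; row \<open>k\<close> is the \<open>k\<close>-th draw and column \<open>j\<close> lists the
  values of coordinate \<open>j\<close> over all draws.
\<close>

definition bernoulli_array :: "(nat \<Rightarrow> real) \<Rightarrow> (nat \<times> nat \<Rightarrow> bool) measure"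
  where "bernoulli_array p = (\<Pi>\<^sub>M kj\<in>UNIV. measure_pmf (bernoulli_pmf (p (snd kj))))"

locale bernoulli_seq =
  fixes p :: "nat \<Rightarrow> real"
  assumes p_nonneg: "0 \<le> p j" and p_le_1: "p j \<le> 1"
begin

abbreviation "N \<equiv> bernoulli_array p"
abbreviation "Q \<equiv> bernoulli_product p"

sublocale array: product_prob_space "\<lambda>kj. measure_pmf (bernoulli_pmf (p (snd kj)))" "UNIV :: (nat \<times> nat) set"
  by unfold_locales

sublocale prob_space N
  unfolding bernoulli_array_def by unfold_locales

lemma sets_bernoulli_product: "sets Q = sets cube"
  unfolding bernoulli_product_def cube_def by (intro sets_PiM_cong) auto

sublocale Q: cube_measure Q
proof (unfold cube_measure_def cube_measure_axioms_def, intro conjI sets_bernoulli_product)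
  show "prob_space Q"
    unfolding bernoulli_product_def by (intro prob_space_PiM) unfold_locales
qed

lemma space_N: "space N = UNIV"
  by (simp add: bernoulli_array_def space_PiM)

lemma measurable_entry[measurable]: "(\<lambda>\<omega>. \<omega> kj) \<in> measurable N (count_space UNIV)"
proof -
  have "(\<lambda>\<omega>. \<omega> kj) \<in> measurable N (measure_pmf (bernoulli_pmf (p (snd kj))))"
    unfolding bernoulli_array_def by measurable
  then show ?thesis
    by simp
qed

lemma distr_entry: "distr N (count_space UNIV) (\<lambda>\<omega>. \<omega> kj) = measure_pmf (bernoulli_pmf (p (snd kj)))"
proof -
  have "distr N (count_space UNIV) (\<lambda>\<omega>. \<omega> kj)
      = distr N (measure_pmf (bernoulli_pmf (p (snd kj)))) (\<lambda>\<omega>. \<omega> kj)"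
    by (intro distr_cong) auto
  also have "\<dots> = measure_pmf (bernoulli_pmf (p (snd kj)))"
    unfolding bernoulli_array_def
    by (rule distr_PiM_component[where M = "\<lambda>kj. measure_pmf (bernoulli_pmf (p (snd kj)))"])
      (auto intro: prob_space_measure_pmf)
  finally show ?thesis .
qed

text \<open>With \<open>f = Pair k\<close> this says that row \<open>k\<close> has the law of one
  draw; for general injective \<open>f\<close> it yields independence of the selected
  entries.\<close>

lemma distr_reindex:
  assumes "inj f"
  shows "distr N (\<Pi>\<^sub>M i\<in>UNIV. count_space UNIV) (\<lambda>\<omega> i. \<omega> (f i))
    = (\<Pi>\<^sub>M i\<in>UNIV. measure_pmf (bernoulli_pmf (p (snd (f i)))))"
proof -
  have "distr N (\<Pi>\<^sub>M i\<in>UNIV. count_space UNIV) (\<lambda>\<omega> i. \<omega> (f i))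
      = distr N (\<Pi>\<^sub>M i\<in>UNIV. measure_pmf (bernoulli_pmf (p (snd (f i))))) (\<lambda>\<omega>. \<lambda>i\<in>UNIV. \<omega> (f i))"
    by (intro distr_cong sets_PiM_cong) auto
  also have "\<dots> = (\<Pi>\<^sub>M i\<in>UNIV. measure_pmf (bernoulli_pmf (p (snd (f i)))))"
    unfolding bernoulli_array_def
    by (rule distr_PiM_reindex[where M = "\<lambda>kj. measure_pmf (bernoulli_pmf (p (snd kj)))"])
      (use assms in \<open>auto intro: prob_space_measure_pmf\<close>)
  finally show ?thesis .
qed

lemma indep_entries:
  assumes "inj f"
  shows "indep_vars (\<lambda>_. count_space UNIV) (\<lambda>i \<omega>. \<omega> (f i)) UNIV"
  using distr_reindex[OF assms]
  by (subst indep_vars_iff_distr_eq_PiM) (auto simp: distr_entry restrict_UNIV)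

lemma measurable_block[measurable]:
  "(\<lambda>\<omega> i. \<omega> (f i)) \<in> measurable N (\<Pi>\<^sub>M i\<in>UNIV. count_space UNIV)"
proof -
  have "(\<lambda>\<omega>. \<lambda>i\<in>UNIV. \<omega> (f i)) \<in> measurable N (\<Pi>\<^sub>M i\<in>UNIV. count_space UNIV)"
    by (intro measurable_restrict) simp
  then show ?thesis
    by (simp add: restrict_UNIV)
qed

text \<open>The hypothesis makes the index ranges of different blocks disjoint. The same lemma is
  applied to rows, which are the draws, and to columns, which are the coordinates.\<close>

lemma indep_blocks:
  fixes g :: "nat \<Rightarrow> nat \<Rightarrow> nat \<times> nat"
  assumes g: "\<And>i k i' k'. g i k = g i' k' \<Longrightarrow> i = i'"
  shows "indep_vars (\<lambda>_. cube) (\<lambda>i \<omega> k. \<omega> (g i k)) UNIV"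
proof -
  have "indep_vars (\<lambda>i. PiM (range (g i)) (\<lambda>_. count_space UNIV))
      (\<lambda>i \<omega>. restrict (\<lambda>kj. \<omega> kj) (range (g i))) UNIV"
    by (rule indep_vars_restrict[OF indep_entries[of id, simplified]])
      (auto simp: disjoint_family_on_def dest: g)
  then have "indep_vars (\<lambda>_. cube)
      (\<lambda>i \<omega>. (\<lambda>x k. x (g i k)) (restrict (\<lambda>kj. \<omega> kj) (range (g i)))) UNIV"
  proof (rule indep_vars_compose2)
    fix i
    have "(\<lambda>x. \<lambda>k\<in>UNIV. x (g i k)) \<in> measurable (PiM (range (g i)) (\<lambda>_. count_space UNIV)) cube"
      unfolding cube_def by (intro measurable_restrict measurable_component_singleton) auto
    then show "(\<lambda>x k. x (g i k)) \<in> measurable (PiM (range (g i)) (\<lambda>_. count_space UNIV)) cube"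
      by (simp add: restrict_UNIV)
  qed
  then show ?thesis
    by simp
qed

text \<open>Moves the \<open>n\<close> draws onto the array, where independence across coordinates
  can be used for all draws simultaneously.\<close>

lemma distr_rows:
  "distr N (\<Pi>\<^sub>M i\<in>{..<n}. Q) (\<lambda>\<omega>. \<lambda>k\<in>{..<n}. \<lambda>j. \<omega> (k, j)) = (\<Pi>\<^sub>M i\<in>{..<n}. Q)"
proof -
  let ?R = "\<lambda>k \<omega> j. \<omega> (k, j)"
  have ind: "indep_vars (\<lambda>_. Q) ?R UNIV"
  proof -
    have "indep_vars (\<lambda>_. cube) ?R UNIV"
      by (rule indep_blocks) auto
    then show ?thesis
      unfolding indep_vars_def
      by (simp add: sets_bernoulli_product cong: measurable_cong_sets)
  qed
  have row: "distr N Q (?R k) = Q" for k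
  proof -
    have "distr N Q (?R k) = distr N (\<Pi>\<^sub>M i\<in>UNIV. count_space UNIV) (?R k)"
      using sets_bernoulli_product by (intro distr_cong) (auto simp: cube_def)
    also have "\<dots> = Q"
      using distr_reindex[of "Pair k"] by (simp add: inj_on_def bernoulli_product_def)
    finally show ?thesis .
  qed
  have meas: "random_variable Q (?R k)" for k
    using ind by (auto simp: indep_vars_def)
  have "n = 0 \<or> {..<n} \<noteq> {}"
    by auto
  then show ?thesis
  proof
    \<comment> \<open>Both sides are then probability measures on a one-point space.\<close>
    assume "n = 0"
    interpret E: prob_space "distr N (\<Pi>\<^sub>M i\<in>{..<n}. Q) (\<lambda>\<omega>. \<lambda>k\<in>{..<n}. ?R k \<omega>)"
      by (intro prob_space_distr measurable_restrict meas)
    show ?thesis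
      using E.emeasure_space_1 \<open>n = 0\<close>
      by (intro measure_eqI) (auto simp: PiM_empty space_PiM dest!: subset_singletonD)
  next
    assume "{..<n} \<noteq> {}"
    then show ?thesis
      using indep_vars_iff_distr_eq_PiM[where I = "{..<n}" and M' = "\<lambda>_. Q" and X = ?R] meas
        indep_vars_subset[OF ind, of "{..<n}"]
      by (simp add: row)
  qed
qed

lemma prob_all_columns:
  assumes "finite J" "J \<noteq> {}" "\<And>j. j \<in> J \<Longrightarrow> {c. P j c} \<in> sets cube"
  shows "prob {\<omega>. \<forall>j\<in>J. P j (\<lambda>k. \<omega> (k, j))} = (\<Prod>j\<in>J. prob {\<omega>. P j (\<lambda>k. \<omega> (k, j))})"
proof -
  have "indep_vars (\<lambda>_. cube) (\<lambda>j \<omega> k. \<omega> (k, j)) UNIV"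
    by (rule indep_blocks) auto
  from indep_varsD[OF this, of J "\<lambda>j. {c. P j c}"] assms show ?thesis
    by (simp add: space_N vimage_def Collect_ball_eq)
qed

lemma mean_bernoulli_product: "mean Q j = p j"
proof -
  have "mean Q j = (\<integral>b. of_bool b \<partial>distr Q (measure_pmf (bernoulli_pmf (p j))) (\<lambda>x. x j))"
    unfolding mean_def by (subst integral_distr) auto
  also have "distr Q (measure_pmf (bernoulli_pmf (p j))) (\<lambda>x. x j) = measure_pmf (bernoulli_pmf (p j))"
    unfolding bernoulli_product_def
    by (rule distr_PiM_component[where M = "\<lambda>j. measure_pmf (bernoulli_pmf (p j))"])
      (auto intro: prob_space_measure_pmf)
  also have "(\<integral>b. of_bool b \<partial>measure_pmf (bernoulli_pmf (p j))) = p j"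
    using p_nonneg p_le_1 by simp
  finally show ?thesis .
qed

lemma Delta_seq_eq:
  "Delta_seq n p = (\<integral>\<omega>. (SUP j. \<bar>(\<Sum>k<n. of_bool (\<omega> (k, j))) / real n - p j\<bar>) \<partial>N)"
proof -
  have meas: "(\<lambda>\<omega>. \<lambda>k\<in>{..<n}. \<lambda>j. \<omega> (k, j)) \<in> measurable N (\<Pi>\<^sub>M i\<in>{..<n}. Q)"
  proof (intro measurable_restrict)
    fix k
    show "(\<lambda>\<omega> j. \<omega> (k, j)) \<in> measurable N Q"
      by (subst measurable_cong_sets[OF refl sets_bernoulli_product]) (simp add: cube_def)
  qed
  have "Delta_seq n p = (\<integral>X. (SUP j. \<bar>emp_mean n X j - mean Q j\<bar>)
      \<partial>distr N (\<Pi>\<^sub>M i\<in>{..<n}. Q) (\<lambda>\<omega>. \<lambda>k\<in>{..<n}. \<lambda>j. \<omega> (k, j)))"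
    by (simp add: Delta_seq_def Delta_def distr_rows)
  also have "\<dots> = (\<integral>\<omega>. (SUP j. \<bar>emp_mean n (\<lambda>k\<in>{..<n}. \<lambda>j. \<omega> (k, j)) j - mean Q j\<bar>) \<partial>N)"
    by (rule integral_distr[OF meas Q.measurable_SUP_deviation])
  finally show ?thesis
    by (simp add: emp_mean_def mean_bernoulli_product)
qed

text \<open>If some column up to \<open>m\<close> satisfies its event, the supremum is at least
  \<open>a\<close>. Independence of the columns turns the probability that none does into a
  product.\<close>

lemma Delta_seq_ge:
  assumes meas: "\<And>j. {c. P j c} \<in> sets cube"
    and dev: "\<And>j c. j \<le> m \<Longrightarrow> P j c \<Longrightarrow> a \<le> \<bar>(\<Sum>k<n. of_bool (c k)) / real n - p j\<bar>"
    and "a \<ge> 0"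
  shows "a * (1 - (\<Prod>j\<le>m. prob {\<omega>. \<not> P j (\<lambda>k. \<omega> (k, j))})) \<le> Delta_seq n p"
proof -
  let ?f = "\<lambda>\<omega>. SUP j. \<bar>(\<Sum>k<n. of_bool (\<omega> (k, j))) / real n - p j\<bar>"
  let ?A = "{\<omega>. \<exists>j\<le>m. P j (\<lambda>k. \<omega> (k, j))}"
  have f_eq: "?f \<omega> = (SUP j. \<bar>emp_mean n (\<lambda>k j. \<omega> (k, j)) j - mean Q j\<bar>)" for \<omega>
    by (simp add: emp_mean_def mean_bernoulli_product)
  have bdd: "bdd_above (range (\<lambda>j. \<bar>(\<Sum>k<n. of_bool (\<omega> (k, j))) / real n - p j\<bar>))" for \<omega>
    using Q.bdd_above_deviation[of n "\<lambda>k j. \<omega> (k, j)"]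
    by (simp add: emp_mean_def mean_bernoulli_product)
  have f01: "0 \<le> ?f \<omega>" "?f \<omega> \<le> 1" for \<omega>
    unfolding f_eq by (rule Q.SUP_deviation_bounds)+
  have compl: "{c. \<not> P j c} \<in> sets cube" for j
    using sets.compl_sets[OF meas[of j]] by (simp add: cube_def space_PiM Compl_eq set_diff_eq)
  have col: "(\<lambda>\<omega> k. \<omega> (k, j)) \<in> measurable N cube" for j
    unfolding cube_def by measurable
  have A: "?A \<in> sets N"
  proof -
    have "?A = (\<Union>j\<in>{..m}. (\<lambda>\<omega> k. \<omega> (k, j)) -` {c. P j c} \<inter> space N)"
      by (auto simp: space_N)
    also have "\<dots> \<in> sets N"
      by (intro sets.finite_UN measurable_sets[OF col] meas) auto
    finally show ?thesis .
  qed
  have "{\<omega>. \<forall>j\<in>{..m}. \<not> P j (\<lambda>k. \<omega> (k, j))} = space N - ?A"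
    by (auto simp: space_N)
  then have "1 - (\<Prod>j\<le>m. prob {\<omega>. \<not> P j (\<lambda>k. \<omega> (k, j))}) = prob ?A"
    using prob_all_columns[of "{..m}" "\<lambda>j c. \<not> P j c"] compl prob_compl[OF A] by simp
  then have "a * (1 - (\<Prod>j\<le>m. prob {\<omega>. \<not> P j (\<lambda>k. \<omega> (k, j))})) = (\<integral>\<omega>. a * indicator ?A \<omega> \<partial>N)"
    using A by simp
  also have "\<dots> \<le> (\<integral>\<omega>. ?f \<omega> \<partial>N)"
  proof (rule integral_mono)
    show "integrable N (\<lambda>\<omega>. a * indicator ?A \<omega>)"
      using A by (intro integrable_mult_right integrable_real_indicator) (auto simp: emeasure_eq_measure)
    show "integrable N ?f"
      using f01 by (intro integrable_const_bound[of _ 1] borel_measurable_cSUP bdd) auto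
    show "a * indicator ?A \<omega> \<le> ?f \<omega>" for \<omega>
    proof (cases "\<omega> \<in> ?A")
      case True
      then obtain j where "j \<le> m" "P j (\<lambda>k. \<omega> (k, j))"
        by auto
      from dev[OF this] have "a \<le> ?f \<omega>"
        using cSUP_upper[OF UNIV_I bdd[of \<omega>], of j] by linarith
      then show ?thesis
        using True by simp
    qed (use f01 in simp)
  qed
  finally show ?thesis
    by (simp add: Delta_seq_eq)
qed

lemma prob_column_all_ones: "prob {\<omega>. \<forall>k<n. \<omega> (k, j)} = p j ^ n"
proof -
  have "emeasure N {\<omega>. \<forall>k<n. \<omega> (k, j)}
      = emeasure (PiM UNIV (\<lambda>kj. measure_pmf (bernoulli_pmf (p (snd kj)))))
          {\<omega> \<in> space (PiM UNIV (\<lambda>kj. measure_pmf (bernoulli_pmf (p (snd kj))))).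
            \<forall>kj\<in>(\<lambda>k. (k, j)) ` {..<n}. \<omega> kj \<in> {True}}"
    unfolding bernoulli_array_def by (intro arg_cong2[where f = emeasure]) (auto simp: space_PiM)
  also have "\<dots> = (\<Prod>kj\<in>(\<lambda>k. (k, j)) ` {..<n}. emeasure (measure_pmf (bernoulli_pmf (p (snd kj)))) {True})"
    by (rule array.emeasure_PiM_Collect) auto
  also have "\<dots> = (\<Prod>k<n. ennreal (p j))"
    using p_nonneg p_le_1
    by (subst prod.reindex) (auto simp: inj_on_def emeasure_pmf_single)
  finally show ?thesis
    using p_nonneg by (simp add: emeasure_eq_measure ennreal_power)
qed

text \<open>A column of ones has empirical mean 1 and deviates by at least \<open>1 / 2\<close>. The
  \<open>j + 1\<close> columns up to \<open>j\<close> all avoid this with probability at most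
  \<open>(1 - p j ^ n) ^ (j + 1)\<close>, hence at most \<open>exp (- 1)\<close>.\<close>

lemma Delta_seq_ge_of_large_entries:
  assumes le: "\<And>i. i \<le> j \<Longrightarrow> p j \<le> p i" "\<And>i. p i \<le> 1 / 2" and "n > 0"
    and large: "1 \<le> real (Suc j) * p j ^ n"
  shows "(1 - exp (- 1)) / 2 \<le> Delta_seq n p"
proof -
  define P where "P i c \<longleftrightarrow> (\<forall>k<n. c k)" for i :: nat and c :: "nat \<Rightarrow> bool"
  have "prob {\<omega>. \<not> P i (\<lambda>k. \<omega> (k, i))} \<le> 1 - p j ^ n" if "i \<le> j" for i
  proof -
    have sets: "{\<omega>. \<forall>k<n. \<omega> (k, i)} \<in> events"
    proof -
      have "{\<omega> \<in> space N. \<forall>k\<in>{..<n}. \<omega> (k, i)} \<in> events"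
        by measurable
      then show ?thesis
        by (simp add: space_N Ball_def)
    qed
    have "{\<omega>. \<not> P i (\<lambda>k. \<omega> (k, i))} = space N - {\<omega>. \<forall>k<n. \<omega> (k, i)}"
      by (auto simp: P_def space_N)
    then have "prob {\<omega>. \<not> P i (\<lambda>k. \<omega> (k, i))} = 1 - p i ^ n"
      using prob_compl[OF sets] prob_column_all_ones[of n i] by simp
    then show ?thesis
      using power_mono[OF le(1)[OF that] p_nonneg, of n] by simp
  qed
  then have "(\<Prod>i\<le>j. prob {\<omega>. \<not> P i (\<lambda>k. \<omega> (k, i))}) \<le> (\<Prod>i\<le>j. 1 - p j ^ n)"
    by (intro prod_mono) auto
  also have "\<dots> \<le> (\<Prod>i\<le>j. exp (- (p j ^ n)))"
    using p_nonneg p_le_1 exp_ge_add_one_self[of "- (p j ^ n)"]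
    by (intro prod_mono) (auto simp: power_le_one)
  also have "\<dots> = exp (- (real (Suc j) * p j ^ n))"
    by (simp add: exp_of_nat_mult[symmetric] exp_add[symmetric] algebra_simps)
  also have "\<dots> \<le> exp (- 1)"
    using large by simp
  finally have "(1 - exp (- 1)) / 2 \<le> 1 / 2 * (1 - (\<Prod>i\<le>j. prob {\<omega>. \<not> P i (\<lambda>k. \<omega> (k, i))}))"
    by simp
  also have "\<dots> \<le> Delta_seq n p"
  proof (rule Delta_seq_ge)
    have "{c. \<forall>k<n. c k} = {c \<in> space cube. \<forall>k\<in>{..<n}. c k}"
      by (auto simp: cube_def space_PiM)
    also have "\<dots> \<in> sets cube"
      unfolding cube_def by measurable
    finally show "{c. P i c} \<in> sets cube" for i
      by (simp add: P_def)
    show "1 / 2 \<le> \<bar>(\<Sum>k<n. of_bool (c k)) / real n - p i\<bar>" if "P i c" for i c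
    proof -
      have "(\<Sum>k<n. of_bool (c k) :: real) = (\<Sum>k<n. 1)"
        using that by (intro sum.cong) (auto simp: P_def)
      then show ?thesis
        using \<open>n > 0\<close> le(2)[of i] by simp
    qed
  qed simp
  finally show ?thesis .
qed

end

subsection \<open>The lower bound\<close>

text \<open>Makes the normal cdf continuous, so that weak convergence gives convergence of the cdfs
  at every point.\<close>

lemma measure_std_normal_singleton: "measure std_normal_distribution {x} = 0"
proof -
  have "AE y in lborel. y \<in> {x} \<longrightarrow> ennreal (std_normal_density y) = 0"
    using AE_lborel_singleton[of x] by (rule eventually_mono) simp
  then have "{x} \<in> null_sets std_normal_distribution"
    by (subst null_sets_density_iff) auto
  then show ?thesis
    by (simp add: null_sets_def measure_def)
qed

text \<open>The interval \<open>{x<..x+1}\<close> has mass at least the density at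
  \<open>x + 1\<close>, because the density decreases on the nonnegative axis. Then
  \<open>(x + 1)\<^sup>2 / 2 \<le> x\<^sup>2 + 1\<close>, and the factor 9 comes from
  \<open>sqrt (2 * pi) \<le> 3\<close> and \<open>exp 1 \<le> 3\<close>.\<close>

lemma std_normal_tail:
  assumes "x \<ge> 0"
  shows "cdf std_normal_distribution x \<le> 1 - exp (- x\<^sup>2) / 9"
proof -
  interpret real_distribution std_normal_distribution
    by (rule real_dist_normal_dist)
  define c where "c = std_normal_density (x + 1)"
  have "c \<ge> 0"
    by (simp add: c_def normal_density_nonneg)
  have "ennreal c = (\<integral>\<^sup>+y. ennreal c * indicator {x<..x+1} y \<partial>lborel)"
    by (simp add: nn_integral_cmult_indicator)
  also have "\<dots> \<le> (\<integral>\<^sup>+y. ennreal (std_normal_density y) * indicator {x<..x+1} y \<partial>lborel)"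
  proof (intro nn_integral_mono)
    fix y
    show "ennreal c * indicator {x<..x+1} y \<le> ennreal (std_normal_density y) * indicator {x<..x+1} y"
    proof (cases "y \<in> {x<..x+1}")
      case True
      then have "y\<^sup>2 \<le> (x + 1)\<^sup>2"
        using assms by (intro power_mono) auto
      then have "c \<le> std_normal_density y"
        by (simp add: c_def normal_density_def divide_right_mono)
      then show ?thesis
        using True by (simp add: ennreal_leI)
    qed simp
  qed
  also have "\<dots> = emeasure std_normal_distribution {x<..x+1}"
    by (simp add: emeasure_density)
  finally have "c \<le> prob {x<..x+1}"
    using \<open>c \<ge> 0\<close> by (simp add: emeasure_eq_measure)
  also have "\<dots> \<le> prob (space std_normal_distribution - {..x})"
    by (intro finite_measure_mono) auto
  also have "\<dots> = 1 - cdf std_normal_distribution x"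
    by (subst prob_compl) (auto simp: cdf_def)
  finally have c: "c \<le> 1 - cdf std_normal_distribution x" .
  have "exp (- x\<^sup>2) / 9 = (1 / 3) * (1 / 3 * exp (- x\<^sup>2))"
    by simp
  also have "\<dots> \<le> (1 / sqrt (2 * pi)) * (exp (- 1) * exp (- x\<^sup>2))"
  proof (intro mult_mono)
    have "sqrt (2 * pi) \<le> sqrt (3\<^sup>2)"
      using pi_less_4 by (intro real_sqrt_le_mono) simp
    then show "1 / 3 \<le> 1 / sqrt (2 * pi)"
      by (intro divide_left_mono) auto
    have "exp 1 \<le> (3 :: real)"
      using e_less_272 by simp
    then show "1 / 3 \<le> (exp (- 1) :: real)"
      by (simp add: exp_minus field_simps)
  qed auto
  also have "\<dots> \<le> (1 / sqrt (2 * pi)) * exp (- (x + 1)\<^sup>2 / 2)"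
  proof (intro mult_left_mono)
    have "0 \<le> (x - 1)\<^sup>2"
      by simp
    then have "- 1 + - x\<^sup>2 \<le> - (x + 1)\<^sup>2 / 2"
      by (simp add: power2_eq_square field_simps)
    then show "exp (- 1) * exp (- x\<^sup>2) \<le> exp (- (x + 1)\<^sup>2 / 2)"
      unfolding exp_add[symmetric] by (simp only: exp_le_cancel_iff)
  qed simp
  also have "\<dots> = c"
    by (simp add: c_def normal_density_def)
  finally show ?thesis
    using c by simp
qed

context bernoulli_seq
begin

lemma integral_entry: "(\<integral>\<omega>. f (\<omega> kj) \<partial>N) = p (snd kj) * f True + (1 - p (snd kj)) * f False"
  for f :: "bool \<Rightarrow> real"
proof -
  have "(\<integral>\<omega>. f (\<omega> kj) \<partial>N) = (\<integral>b. f b \<partial>distr N (count_space UNIV) (\<lambda>\<omega>. \<omega> kj))"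
    by (subst integral_distr) auto
  also have "\<dots> = p (snd kj) * f True + (1 - p (snd kj)) * f False"
    unfolding distr_entry using p_nonneg p_le_1 by simp
  finally show ?thesis .
qed

lemma normalized_sum_cdf_tendsto:
  assumes "0 < p j" "p j < 1"
  shows "(\<lambda>n. prob {\<omega>. (\<Sum>k<n. of_bool (\<omega> (k, j)) - p j) / sqrt (real n * (p j * (1 - p j))) \<le> t})
    \<longlonglongrightarrow> cdf std_normal_distribution t"
proof -
  define X :: "nat \<Rightarrow> (nat \<times> nat \<Rightarrow> bool) \<Rightarrow> real" where "X k \<omega> = of_bool (\<omega> (k, j))" for k \<omega>
  define \<sigma> where "\<sigma> = sqrt (p j * (1 - p j))"
  have \<sigma>: "\<sigma> > 0" "\<sigma>\<^sup>2 = p j * (1 - p j)"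
    using assms by (auto simp: \<sigma>_def)
  have X_meas[measurable]: "X k \<in> borel_measurable N" for k
    unfolding X_def by measurable
  have exp_X: "expectation (X k) = p j" for k
    using integral_entry[of of_bool "(k, j)"] by (simp add: X_def[abs_def])
  have "weak_conv_m (\<lambda>n. distr N borel (\<lambda>\<omega>. (\<Sum>k<n. X k \<omega> - p j) / sqrt (real n * \<sigma>\<^sup>2)))
      std_normal_distribution"
  proof (rule central_limit_theorem)
    have "indep_vars (\<lambda>_. count_space UNIV) (\<lambda>k \<omega>. \<omega> (k, j)) UNIV"
      by (rule indep_entries) (auto simp: inj_on_def)
    then have "indep_vars (\<lambda>_. borel) (\<lambda>k \<omega>. of_bool (\<omega> (k, j)) :: real) UNIV"
      by (rule indep_vars_compose2[where Y = "\<lambda>_. of_bool"]) auto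
    then show "indep_vars (\<lambda>_. borel) X UNIV"
      by (simp add: X_def[abs_def])
    show "integrable N (\<lambda>\<omega>. (X k \<omega>)\<^sup>2)" for k
      by (intro integrable_const_bound[of _ 1]) (auto simp: X_def)
    show "variance (X k) = \<sigma>\<^sup>2" for k
    proof -
      have "expectation (\<lambda>\<omega>. (X k \<omega> - p j)\<^sup>2) = p j * (1 - p j)\<^sup>2 + (1 - p j) * (p j)\<^sup>2"
        using integral_entry[of "\<lambda>b. (of_bool b - p j)\<^sup>2" "(k, j)"] by (simp add: X_def)
      also have "\<dots> = \<sigma>\<^sup>2"
        unfolding \<sigma>(2) by (simp add: power2_eq_square algebra_simps)
      finally show ?thesis
        unfolding exp_X .
    qed
    show "distr N borel (X k) = distr (measure_pmf (bernoulli_pmf (p j))) borel of_bool" for k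
      using distr_distr[of of_bool "count_space UNIV" borel "\<lambda>\<omega>. \<omega> (k, j)" N, symmetric]
      by (simp add: distr_entry X_def[abs_def] comp_def)
  qed (use \<sigma> exp_X in auto)
  moreover have "isCont (cdf std_normal_distribution) t"
  proof -
    interpret normal: real_distribution std_normal_distribution
      by (rule real_dist_normal_dist)
    show ?thesis
      by (simp add: normal.isCont_cdf measure_std_normal_singleton)
  qed
  ultimately have "(\<lambda>n. cdf (distr N borel (\<lambda>\<omega>. (\<Sum>k<n. X k \<omega> - p j) / sqrt (real n * \<sigma>\<^sup>2))) t)
      \<longlonglongrightarrow> cdf std_normal_distribution t"
    by (auto simp: weak_conv_m_def weak_conv_def)
  moreover have "cdf (distr N borel (\<lambda>\<omega>. (\<Sum>k<n. X k \<omega> - p j) / sqrt (real n * \<sigma>\<^sup>2))) t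
      = prob {\<omega>. (\<Sum>k<n. of_bool (\<omega> (k, j)) - p j) / sqrt (real n * (p j * (1 - p j))) \<le> t}" for n
    by (simp add: cdf_def measure_distr space_N vimage_def X_def \<sigma>)
  ultimately show ?thesis
    by simp
qed

text \<open>Monotonicity and \<open>p i \<le> 1 / 2\<close> give every column
  \<open>i \<le> j\<close> variance at least \<open>p j / 2\<close>. By the central limit theorem
  and independence, the probability that no normalized sum among these \<open>j + 1\<close> columns
  exceeds \<open>t\<close> tends to \<open>F ^ (j + 1)\<close>, which stays below 1 uniformly in
  \<open>j\<close>.\<close>

lemma liminf_Delta_seq_ge:
  assumes anti: "antimono p" and half: "\<And>i. p i \<le> 1 / 2"
  shows "ereal ((1 - exp (- 1 / 18)) * sqrt (1 / 2) * sqrt (p j * ln (real j + 2)))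
    \<le> liminf (\<lambda>n. ereal (sqrt (real n) * Delta_seq n p))"
proof (cases "p j > 0")
  case False
  have "0 \<le> sqrt (real n) * Delta_seq n p" for n
    using Q.Delta_nonneg by (simp add: Delta_seq_def)
  then have "ereal 0 \<le> liminf (\<lambda>n. ereal (sqrt (real n) * Delta_seq n p))"
    by (intro Liminf_bounded always_eventually) auto
  then show ?thesis
    using False p_nonneg[of j] by (simp add: order_less_le)
next
  case True
  \<comment> \<open>At this threshold the tail bound equals \<open>1 / (9 * (j + 2))\<close>, which
    matches the number of available columns.\<close>
  define t where "t = sqrt (ln (real j + 2))"
  define b where "b = t * sqrt (p j / 2)"
  define Z where "Z n i c = (\<Sum>k<n. of_bool (c k) - p i) / sqrt (real n * (p i * (1 - p i)))"
    for n i and c :: "nat \<Rightarrow> bool"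
  define F where "F = cdf std_normal_distribution t"
  have t: "t \<ge> 0" "t\<^sup>2 = ln (real j + 2)"
    by (auto simp: t_def)
  have b: "b \<ge> 0"
    using t True by (simp add: b_def)
  have p: "p j \<le> p i" "0 < p i" "p i < 1" if "i \<le> j" for i
    using antimonoD[OF anti that] True half[of i] by auto
  have ge: "b * (1 - (\<Prod>i\<le>j. prob {\<omega>. Z n i (\<lambda>k. \<omega> (k, i)) \<le> t})) \<le> sqrt (real n) * Delta_seq n p"
    if n: "n > 0" for n
  proof -
    have "b / sqrt (real n) * (1 - (\<Prod>i\<le>j. prob {\<omega>. \<not> t < Z n i (\<lambda>k. \<omega> (k, i))})) \<le> Delta_seq n p"
    proof (rule Delta_seq_ge)
      have "{c. t < Z n i c} = {c \<in> space cube. t < Z n i c}" for i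
        by (auto simp: cube_def space_PiM)
      also have "\<dots> i \<in> sets cube" for i
        unfolding cube_def Z_def by measurable
      finally show "{c. t < Z n i c} \<in> sets cube" for i .
      fix i c
      assume i: "i \<le> j" and Z: "t < Z n i c"
      have "p j / 2 \<le> p i * (1 - p i)"
        using mult_mono[of "p j" "p i" "1 / 2" "1 - p i"] p[OF i] half[of i] by simp
      then have "b \<le> t * sqrt (p i * (1 - p i))"
        unfolding b_def using t by (intro mult_left_mono) auto
      also have "\<dots> \<le> Z n i c * sqrt (p i * (1 - p i))"
        using Z p[OF i] by (intro mult_right_mono) auto
      also have "\<dots> = (\<Sum>k<n. of_bool (c k) - p i) / sqrt (real n)"
        using p[OF i] n by (simp add: Z_def real_sqrt_mult)
      finally have "b / sqrt (real n) \<le> (\<Sum>k<n. of_bool (c k) - p i) / sqrt (real n) / sqrt (real n)"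
        by (intro divide_right_mono) auto
      also have "\<dots> = (\<Sum>k<n. of_bool (c k)) / real n - p i"
        using n by (simp add: sum_subtractf diff_divide_distrib)
      finally show "b / sqrt (real n) \<le> \<bar>(\<Sum>k<n. of_bool (c k)) / real n - p i\<bar>"
        by simp
    qed (use b in simp)
    then have "sqrt (real n) * (b / sqrt (real n) * (1 - (\<Prod>i\<le>j. prob {\<omega>. \<not> t < Z n i (\<lambda>k. \<omega> (k, i))})))
        \<le> sqrt (real n) * Delta_seq n p"
      by (intro mult_left_mono) auto
    then show ?thesis
      using n by (simp add: not_less)
  qed
  have "(\<lambda>n. b * (1 - (\<Prod>i\<le>j. prob {\<omega>. Z n i (\<lambda>k. \<omega> (k, i)) \<le> t}))) \<longlonglongrightarrow> b * (1 - (\<Prod>i\<le>j. F))"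
    unfolding Z_def F_def using p by (intro tendsto_intros normalized_sum_cdf_tendsto) auto
  then have "(\<lambda>n. ereal (b * (1 - (\<Prod>i\<le>j. prob {\<omega>. Z n i (\<lambda>k. \<omega> (k, i)) \<le> t}))))
      \<longlonglongrightarrow> ereal (b * (1 - (\<Prod>i\<le>j. F)))"
    by simp
  then have "ereal (b * (1 - (\<Prod>i\<le>j. F)))
      = liminf (\<lambda>n. ereal (b * (1 - (\<Prod>i\<le>j. prob {\<omega>. Z n i (\<lambda>k. \<omega> (k, i)) \<le> t}))))"
    by (intro lim_imp_Liminf[symmetric]) auto
  also have "\<dots> \<le> liminf (\<lambda>n. ereal (sqrt (real n) * Delta_seq n p))"
    by (rule Liminf_mono, rule eventually_mono[OF eventually_gt_at_top[of 0]]) (use ge in auto)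
  finally have lim: "ereal (b * (1 - (\<Prod>i\<le>j. F))) \<le> liminf (\<lambda>n. ereal (sqrt (real n) * Delta_seq n p))" .
  have "F \<le> 1 - exp (- ln (real j + 2)) / 9"
    unfolding F_def using std_normal_tail[OF t(1)] t(2) by simp
  also have "\<dots> = 1 - 1 / (9 * (real j + 2))"
    by (simp add: exp_minus field_simps)
  also have "\<dots> \<le> exp (- (1 / (9 * (real j + 2))))"
    using exp_ge_add_one_self[of "- (1 / (9 * (real j + 2)))"] by simp
  finally have "(\<Prod>i\<le>j. F) \<le> (\<Prod>i\<le>j. exp (- (1 / (9 * (real j + 2)))))"
    by (intro prod_mono) (auto simp: F_def cdf_def)
  also have "\<dots> = exp (- (real (Suc j) / (9 * (real j + 2))))"
    by (simp only: prod_constant card_atMost exp_of_nat_mult[symmetric]) simp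
  \<comment> \<open>Uses \<open>(j + 1) / (j + 2) \<ge> 1 / 2\<close>, with equality at
    \<open>j = 0\<close>.\<close>
  also have "\<dots> \<le> exp (- 1 / 18)"
    by (simp add: field_simps)
  finally have "b * (1 - exp (- 1 / 18)) \<le> b * (1 - (\<Prod>i\<le>j. F))"
    using b by (intro mult_left_mono) auto
  moreover have "b * (1 - exp (- 1 / 18)) = (1 - exp (- 1 / 18)) * sqrt (1 / 2) * sqrt (p j * ln (real j + 2))"
    by (simp add: b_def t_def real_sqrt_mult real_sqrt_divide)
  ultimately have "ereal ((1 - exp (- 1 / 18)) * sqrt (1 / 2) * sqrt (p j * ln (real j + 2)))
      \<le> ereal (b * (1 - (\<Prod>i\<le>j. F)))"
    by (simp only: ereal_less_eq(3))
  from order_trans[OF this lim] show ?thesis .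
qed

end

section \<open>Finiteness of \<open>T\<close> on \<open>LGC\<close>\<close>

text \<open>If \<open>T\<close> were infinite, each \<open>n > 0\<close> would admit
  \<open>j\<close> with \<open>p j ^ n > 1 / sqrt (j + 2)\<close>, hence
  \<open>(j + 1) * p j ^ n \<ge> 1\<close>. Then \<open>Delta_seq n p\<close> would stay above a
  positive constant.\<close>

lemma T_seq_finite_of_LGC:
  assumes "p \<in> LGC"
  shows "T_seq p < \<infinity>"
proof (rule ccontr)
  assume "\<not> T_seq p < \<infinity>"
  then have T: "T_seq p = \<infinity>"
    by simp
  have p: "0 \<le> p j" "p j \<le> 1 / 2" "antimono p" and lim: "(\<lambda>n. Delta_seq n p) \<longlonglongrightarrow> 0" for j
    using assms by (auto simp: LGC_def decreasing_null_seqs_def)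
  interpret bernoulli_seq p
    by unfold_locales (use p in \<open>auto intro: order_trans[OF p(2)]\<close>)
  have "(1 - exp (- 1)) / 2 \<le> Delta_seq n p" if n: "n > 0" for n
  proof -
    \<comment> \<open>The factor 2 absorbs the mismatch between the weight \<open>j + 2\<close> and
      the column count \<open>j + 1\<close>: \<open>j + 2 \<le> (j + 1)\<^sup>2\<close> for
      \<open>j > 0\<close>.\<close>
    have "ereal (real n * 2) < T_seq p"
      by (simp add: T)
    then obtain j where j: "real n * 2 < (if p j = 0 then 0 else ln (real j + 2) / ln (1 / p j))"
      unfolding T_seq_def less_SUP_iff by auto
    then have "p j \<noteq> 0"
      by (auto split: if_splits)
    then have pj: "p j > 0"
      using p(1)[of j] by simp
    then have "ln (1 / p j) > 0"
      using p(2)[of j] by (intro ln_gt_zero) (simp add: field_simps)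
    then have "real n * 2 * ln (1 / p j) < ln (real j + 2)"
      using j \<open>p j \<noteq> 0\<close> by (simp add: pos_less_divide_eq)
    then have "- ln (real j + 2) / 2 < ln (p j ^ n)"
      using pj by (simp add: ln_div ln_realpow)
    moreover have "ln (real j + 2) / 2 \<le> ln (real (Suc j))" if "j > 0"
    proof -
      have "real j + 2 \<le> (real (Suc j))\<^sup>2"
        using that by (simp add: power2_eq_square algebra_simps add_increasing2)
      then have "ln (real j + 2) \<le> ln ((real (Suc j))\<^sup>2)"
        by (subst ln_le_cancel_iff) auto
      then show ?thesis
        by (simp add: ln_realpow)
    qed
    \<comment> \<open>At \<open>j = 0\<close> the quotient is at most 1, because
      \<open>p 0 \<le> 1 / 2\<close>, and cannot exceed \<open>2 * n\<close>.\<close>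
    moreover have "j > 0"
    proof (rule ccontr)
      assume "\<not> j > 0"
      then have "real n * 2 * ln (1 / p 0) < ln 2"
        using \<open>real n * 2 * ln (1 / p j) < ln (real j + 2)\<close> by simp
      moreover have "ln 2 \<le> ln (1 / p 0)"
        using pj p(2)[of 0] \<open>\<not> j > 0\<close> by (subst ln_le_cancel_iff) (auto simp: field_simps)
      moreover have "1 * ln (1 / p 0) \<le> real n * 2 * ln (1 / p 0)"
        using n order_trans[OF _ \<open>ln 2 \<le> ln (1 / p 0)\<close>, of 0] by (intro mult_right_mono) auto
      ultimately show False
        by simp
    qed
    ultimately have "0 \<le> ln (real (Suc j)) + ln (p j ^ n)"
      by linarith
    also have "\<dots> = ln (real (Suc j) * p j ^ n)"
      using pj by (subst ln_mult) auto
    finally have "1 \<le> real (Suc j) * p j ^ n"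
      using pj by (subst (asm) ln_ge_zero_iff) auto
    then show ?thesis
      using n p by (intro Delta_seq_ge_of_large_entries) (auto dest: antimonoD)
  qed
  then have "\<forall>\<^sub>F n in sequentially. (1 - exp (- 1)) / 2 \<le> Delta_seq n p"
    using eventually_gt_at_top[of 0] by (rule eventually_mono[rotated])
  from tendsto_lowerbound[OF lim this] show False
    by simp
qed

theorem theorem2:
  shows "\<exists>c c' :: real. c > 0 \<and> c' > 0 \<and>
    (\<forall>M p. product_prob_on_cube M \<longrightarrow> p = mean M \<longrightarrow> p \<in> LGC \<longrightarrow>
       ereal c * esqrt (S_seq p) \<le> liminf (\<lambda>n. ereal (sqrt (real n) * Delta_seq n p)) \<and>
       liminf (\<lambda>n. ereal (sqrt (real n) * Delta_seq n p))
         \<le> limsup (\<lambda>n. ereal (sqrt (real n) * Delta_seq n p)) \<and>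
       limsup (\<lambda>n. ereal (sqrt (real n) * Delta_seq n p)) \<le> ereal c' * esqrt (S_seq p)) \<and>
    (\<forall>M. prob_on_cube M \<longrightarrow> T_meas M < \<infinity> \<longrightarrow>
       limsup (\<lambda>n. ereal (sqrt (real n) * Delta n M)) \<le> ereal c' * esqrt (S_meas M))"
proof -
  define c :: real where "c = (1 - exp (- 1 / 18)) * sqrt (1 / 2)"
  have c: "c > 0"
    by (simp add: c_def)
  have "ereal c * esqrt (S_seq p) \<le> liminf (\<lambda>n. ereal (sqrt (real n) * Delta_seq n p)) \<and>
      limsup (\<lambda>n. ereal (sqrt (real n) * Delta_seq n p)) \<le> ereal 6 * esqrt (S_seq p)"
    if LGC: "p \<in> LGC" for p
  proof -
    have p: "0 \<le> p j" "p j \<le> 1 / 2" "antimono p" for j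
      using LGC by (auto simp: LGC_def decreasing_null_seqs_def)
    interpret bernoulli_seq p
      by unfold_locales (use p in \<open>auto intro: order_trans[OF p(2)]\<close>)
    obtain T where T: "T \<ge> 0"
      "\<And>j. 0 < p j \<Longrightarrow> p j \<le> 1 / 2 \<Longrightarrow> ln (real j + 2) \<le> T * ln (1 / p j)"
      using T_seq_upper[OF T_seq_finite_of_LGC[OF LGC]] by metis
    define L where "L = liminf (\<lambda>n. ereal (sqrt (real n) * Delta_seq n p))"
    have low: "ereal (c * sqrt (p j * ln (real j + 2))) \<le> L" for j
      using liminf_Delta_seq_ge[OF p(3) p(2), of j] by (simp add: c_def L_def)
    obtain S where S: "S_seq p = ereal S" "S \<ge> 0" "\<And>j. p j * ln (real j + 2) \<le> S"
    proof -
      \<comment> \<open>Finiteness of \<open>S\<close> follows from that of \<open>T\<close>, since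
        \<open>x * ln (1 / x) \<le> 1\<close> for \<open>x > 0\<close>.\<close>
      have "p j * ln (real j + 2) \<le> T" for j
      proof (cases "p j > 0")
        case True
        have "p j * ln (real j + 2) \<le> p j * (T * ln (1 / p j))"
          using T(2)[OF True p(2)] True by (intro mult_left_mono) auto
        also have "\<dots> = T * (p j * ln (1 / p j))"
          by simp
        also have "p j * ln (1 / p j) \<le> p j * (1 / p j - 1)"
          using True by (intro mult_left_mono ln_le_minus_one) auto
        also have "\<dots> \<le> 1"
          using True by (simp add: right_diff_distrib)
        finally show ?thesis
          using T(1) by (simp add: mult_left_mono)
      next
        case False
        then show ?thesis
          using p(1)[of j] T(1) by simp
      qed
      then have "S_seq p \<le> ereal T"
        unfolding S_seq_def by (intro SUP_least) auto
      then have "S_seq p \<noteq> \<infinity>"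
        by auto
      then show ?thesis
        using S_seq_cases[of p] p(1) that by metis
    qed
    \<comment> \<open>The lower bound is known for each \<open>j\<close> with the same
      \<open>c\<close> and \<open>L\<close>; squaring the inequality allows the supremum over
      \<open>j\<close> to be taken under the root.\<close>
    have "ereal (c * sqrt S) \<le> L"
    proof (cases L)
      case (real l)
      have l: "c * sqrt (p j * ln (real j + 2)) \<le> l" for j
        using low[of j] real by simp
      have "0 \<le> c * sqrt (p 0 * ln (real 0 + 2))"
        using c p(1)[of 0] by simp
      then have "l \<ge> 0"
        using l[of 0] by linarith
      have "p j * ln (real j + 2) \<le> (l / c)\<^sup>2" for j
      proof -
        have "sqrt (p j * ln (real j + 2)) \<le> l / c"
          using l[of j] c by (simp add: field_simps)
        then show ?thesis
          by (rule sqrt_le_D)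
      qed
      then have "S_seq p \<le> ereal ((l / c)\<^sup>2)"
        unfolding S_seq_def by (intro SUP_least) auto
      then have "sqrt S \<le> l / c"
        using S \<open>l \<ge> 0\<close> c by (intro real_le_lsqrt) auto
      then show ?thesis
        using c real by (simp add: field_simps)
    qed (use low[of 0] in auto)
    moreover have "limsup (\<lambda>n. ereal (sqrt (real n) * Delta_seq n p)) \<le> ereal (6 * sqrt S)"
    proof -
      \<comment> \<open>Entries are at most \<open>1 / 2\<close>, so folding changes nothing, and
        \<open>S_seq p\<close> and \<open>T_seq p\<close> weight coordinate \<open>j\<close> by its
        own index; hence the rank \<open>id\<close> below.\<close>
      have fold: "fold_half (mean Q) = p"
      proof
        show "fold_half (mean Q) j = p j" for j
          using p(2)[of j] by (simp add: fold_half_def mean_bernoulli_product)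
      qed
      show ?thesis
        unfolding Delta_seq_def
        by (rule Q.limsup_Delta_le[where r = id and T = T]) (use S T p in \<open>auto simp: fold\<close>)
    qed
    ultimately show ?thesis
      by (simp add: S esqrt_def L_def)
  qed
  moreover have "liminf (\<lambda>n. ereal (f n)) \<le> limsup (\<lambda>n. ereal (f n))" for f :: "nat \<Rightarrow> real"
    by (rule Liminf_le_Limsup) simp
  ultimately show ?thesis
    using c limsup_Delta_le_S_meas by (intro exI[of _ c] exI[of _ 6]) auto
qed

end
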